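(* Let $K\subset\mathbb{R}$ be a non-empty compact set with $|K|=0$, so that $\mathcal{R}_0(K)=\{J\in\mathcal{J}:\sigma(J)\subset K\}$. For every $J\in\mathcal{R}_0(K)$, there are $J_n\in\mathcal{R}_0(K)$ ($n\in\mathbb{N}$), with associated measures $\rho_n$ satisfying $\rho_n(K)=0$, so that $d(J_n,J)\to 0$.
   Context: A Jacobi matrix is a bounded self-adjoint operator $J$ on $\ell^2(\mathbb{Z})$ of the form $(Ju)(n)=a(n)u(n+1)+a(n-1)u(n-1)+b(n)u(n)$, with $a(n)\ge 0$ (the value $0$ is allowed), $b(n)\in\mathbb{R}$, $a,b\in\ell^\infty(\mathbb{Z})$. The set of all Jacobi matrices is $\mathcal{J}$. The metric $d$ on $\mathcal{J}$ is $d(J,J')=\sum_{n\in\mathbb{Z}}2^{-|n|}\left(|a(n)-a'(n)|+|b(n)-b'(n)|\right)$. $|\cdot|$ is Lebesgue measure and $\sigma(J)$ is the spectrum. The $H$ function of $J$ is $H(z)=-1/g_0(z)$, where $g_0(z)=\langle\delta_0,(J-z)^{-1}\delta_0\rangle$, $z\in\mathbb{C}^+$. It is a Herglotz function with a representation $H(z)=z+A+\int_{\mathbb{R}}\frac{d\rho(t)}{t-z}$, with $A\in\mathbb{R}$ and a unique finite, compactly supported positive Borel measure $\rho$ on $\mathbb{R}$ (possibly zero); this $\rho$ is the measure associated with $J$. *)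

theory Defs
  imports "HOL-Analysis.Analysis"
begin

definition ell2 :: "(int \<Rightarrow> complex) set" where
  "ell2 = {u. (\<lambda>n. (cmod (u n))\<^sup>2) summable_on UNIV}"

definition ell2_inner :: "(int \<Rightarrow> complex) \<Rightarrow> (int \<Rightarrow> complex) \<Rightarrow> complex" where
  "ell2_inner u v = (\<Sum>\<^sub>\<infinity>n. cnj (u n) * v n)"

definition ell2_norm :: "(int \<Rightarrow> complex) \<Rightarrow> real" where
  "ell2_norm u = sqrt (\<Sum>\<^sub>\<infinity>n. (cmod (u n))\<^sup>2)"

definition delta :: "int \<Rightarrow> int \<Rightarrow> complex" where
  "delta k = (\<lambda>n. if n = k then 1 else 0)"

text \<open>A Jacobi matrix is represented by its coefficient sequences \<open>(a, b)\<close>. Nothing is lost: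
  the coefficients can be read off from the operator (\<open>jacobi_op_inject\<close>), and for bounded real
  coefficients the operator is automatically bounded and self-adjoint on \<^const>\<open>ell2\<close>
  (\<open>jacobi_op_bounded\<close>, \<open>jacobi_op_symmetric\<close>).\<close>

type_synonym jacobi = "(int \<Rightarrow> real) \<times> (int \<Rightarrow> real)"

definition jacobi_matrices :: "jacobi set" where
  "jacobi_matrices = {(a, b). (\<forall>n. a n \<ge> 0) \<and> bounded (range a) \<and> bounded (range b)}"

definition jacobi_op :: "jacobi \<Rightarrow> (int \<Rightarrow> complex) \<Rightarrow> (int \<Rightarrow> complex)" where
  "jacobi_op = (\<lambda>(a, b) u n.
     of_real (a n) * u (n + 1) + of_real (a (n - 1)) * u (n - 1) + of_real (b n) * u n)"

definition jacobi_dist :: "jacobi \<Rightarrow> jacobi \<Rightarrow> real" where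
  "jacobi_dist = (\<lambda>(a, b) (a', b').
     \<Sum>\<^sub>\<infinity>n. 2 powi (- \<bar>n\<bar>) * (\<bar>a n - a' n\<bar> + \<bar>b n - b' n\<bar>))"

definition jacobi_shift :: "jacobi \<Rightarrow> complex \<Rightarrow> (int \<Rightarrow> complex) \<Rightarrow> (int \<Rightarrow> complex)" where
  "jacobi_shift J z u = (\<lambda>n. jacobi_op J u n - z * u n)"

text \<open>The inverse of \<open>J - z\<close> on \<^const>\<open>ell2\<close>; only meaningful where \<open>J - z\<close> is a bijection of
  \<^const>\<open>ell2\<close>, in particular for every non-real \<open>z\<close>.\<close>

definition jacobi_resolvent :: "jacobi \<Rightarrow> complex \<Rightarrow> (int \<Rightarrow> complex) \<Rightarrow> (int \<Rightarrow> complex)" where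
  "jacobi_resolvent J z = inv_into ell2 (jacobi_shift J z)"

definition jacobi_resolvent_set :: "jacobi \<Rightarrow> complex set" where
  "jacobi_resolvent_set J = {z. bij_betw (jacobi_shift J z) ell2 ell2 \<and>
     (\<exists>C. \<forall>v\<in>ell2. ell2_norm (jacobi_resolvent J z v) \<le> C * ell2_norm v)}"

definition jacobi_spectrum :: "jacobi \<Rightarrow> complex set" where
  "jacobi_spectrum J = - jacobi_resolvent_set J"

definition R0 :: "real set \<Rightarrow> jacobi set" where
  "R0 K = {J \<in> jacobi_matrices. jacobi_spectrum J \<subseteq> of_real ` K}"

definition g0 :: "jacobi \<Rightarrow> complex \<Rightarrow> complex" where
  "g0 J z = ell2_inner (delta 0) (jacobi_resolvent J z (delta 0))"

definition H_function :: "jacobi \<Rightarrow> complex \<Rightarrow> complex" where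
  "H_function J z = - 1 / g0 J z"

definition associated_measure :: "jacobi \<Rightarrow> real measure \<Rightarrow> bool" where
  "associated_measure J \<rho> \<longleftrightarrow>
     sets \<rho> = sets borel \<and> finite_measure \<rho> \<and>
     (\<exists>C. compact C \<and> emeasure \<rho> (- C) = 0) \<and>
     (\<exists>A::real. \<forall>z. Im z > 0 \<longrightarrow>
        H_function J z = z + of_real A + (\<integral>t. 1 / (of_real t - z) \<partial>\<rho>))"

lemma jacobi_op_inject:
  assumes "\<And>k. jacobi_op J (delta k) = jacobi_op J' (delta k)"
  shows "J = J'"
proof -
  obtain a b a' b' where J: "J = (a, b)" "J' = (a', b')" by (cases J, cases J') auto
  have "a n = a' n" for n
    using fun_cong[OF assms[of "n + 1"], of n] by (simp add: J jacobi_op_def delta_def)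
  moreover have "b n = b' n" for n
    using fun_cong[OF assms[of n], of n] by (simp add: J jacobi_op_def delta_def)
  ultimately show ?thesis by (auto simp: J)
qed

lemma bij_shift: "bij_betw (\<lambda>n::int. n + k) UNIV UNIV"
  by (rule bij_betwI[where g = "\<lambda>n. n - k"]) auto

lemma summable_on_int_shift:
  fixes f :: "int \<Rightarrow> 'a :: {topological_comm_monoid_add, t2_space}"
  shows "(\<lambda>n. f (n + k)) summable_on UNIV \<longleftrightarrow> f summable_on UNIV"
  using summable_on_reindex_bij_betw[OF bij_shift, of f k] .

lemma infsum_int_shift:
  fixes f :: "int \<Rightarrow> 'a :: {topological_comm_monoid_add, t2_space}"
  shows "(\<Sum>\<^sub>\<infinity>n. f (n + k)) = (\<Sum>\<^sub>\<infinity>n. f n)"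
  using infsum_reindex_bij_betw[OF bij_shift, of f k] .

lemma jacobi_matricesE:
  assumes "J \<in> jacobi_matrices"
  obtains a b M where "J = (a, b)" "M \<ge> 0" "\<And>n. \<bar>a n\<bar> \<le> M" "\<And>n. \<bar>b n\<bar> \<le> M"
proof -
  obtain a b where J: "J = (a, b)" by (cases J)
  have "bounded (range a)" "bounded (range b)"
    using assms by (auto simp: J jacobi_matrices_def)
  then obtain M1 M2 where "\<forall>x\<in>range a. norm x \<le> M1" "\<forall>x\<in>range b. norm x \<le> M2"
    unfolding bounded_iff by blast
  then have B: "\<bar>a n\<bar> \<le> M1" "\<bar>b n\<bar> \<le> M2" for n by simp_all
  have "0 \<le> max M1 M2" using B(1)[of 0] by linarith
  moreover have "\<bar>a n\<bar> \<le> max M1 M2" "\<bar>b n\<bar> \<le> max M1 M2" for n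
    using B(1)[of n] B(2)[of n] by linarith+
  ultimately show ?thesis using that[OF J] by blast
qed

lemma jacobi_op_bounded:
  assumes "J \<in> jacobi_matrices"
  shows "\<exists>C. \<forall>u\<in>ell2. jacobi_op J u \<in> ell2 \<and> ell2_norm (jacobi_op J u) \<le> C * ell2_norm u"
proof -
  obtain a b M where J: "J = (a, b)" and M: "M \<ge> 0" "\<And>n. \<bar>a n\<bar> \<le> M" "\<And>n. \<bar>b n\<bar> \<le> M"
    using assms by (blast elim: jacobi_matricesE)
  have "jacobi_op J u \<in> ell2 \<and> ell2_norm (jacobi_op J u) \<le> (3 * M) * ell2_norm u"
    if u: "u \<in> ell2" for u
  proof -
    define f where "f n = (cmod (u n))\<^sup>2" for n
    have f: "f summable_on UNIV" using u by (simp add: ell2_def f_def[abs_def])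
    have f1: "(\<lambda>n. f (n + 1)) summable_on UNIV" and f2: "(\<lambda>n. f (n - 1)) summable_on UNIV"
      using f summable_on_int_shift[of f 1] summable_on_int_shift[of f "- 1"] by simp_all
    have i1: "(\<Sum>\<^sub>\<infinity>n. f (n + 1)) = infsum f UNIV" and i2: "(\<Sum>\<^sub>\<infinity>n. f (n - 1)) = infsum f UNIV"
      using infsum_int_shift[of f 1] infsum_int_shift[of f "- 1"] by simp_all
    define g where "g n = 3 * M\<^sup>2 * (f (n + 1) + f (n - 1) + f n)" for n
    have g: "g summable_on UNIV"
      unfolding g_def by (intro summable_on_cmult_right summable_on_add f f1 f2)
    have le: "(cmod (jacobi_op J u n))\<^sup>2 \<le> g n" for n
    proof -
      define x y w where "x = cmod (u (n + 1))" and "y = cmod (u (n - 1))" and "w = cmod (u n)"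
      have "cmod (jacobi_op J u n) \<le> \<bar>a n\<bar> * x + \<bar>a (n - 1)\<bar> * y + \<bar>b n\<bar> * w"
        unfolding J jacobi_op_def x_def y_def w_def prod.case
        by (intro order.trans[OF norm_triangle_ineq] add_mono) (auto simp: norm_mult)
      also have "\<dots> \<le> M * x + M * y + M * w"
        by (intro add_mono mult_right_mono M) (auto simp: x_def y_def w_def)
      finally have "(cmod (jacobi_op J u n))\<^sup>2 \<le> (M * x + M * y + M * w)\<^sup>2"
        by (intro power_mono) auto
      also have "\<dots> = M\<^sup>2 * (x + y + w)\<^sup>2" by (simp add: power2_eq_square algebra_simps)
      also have "(x + y + w)\<^sup>2 \<le> 3 * (x\<^sup>2 + y\<^sup>2 + w\<^sup>2)"
        using zero_le_power2[of "x - y"] zero_le_power2[of "x - w"] zero_le_power2[of "y - w"]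
        by (simp add: power2_eq_square algebra_simps)
      finally have "(cmod (jacobi_op J u n))\<^sup>2 \<le> M\<^sup>2 * (3 * (x\<^sup>2 + y\<^sup>2 + w\<^sup>2))"
        by (simp add: mult_left_mono)
      then show ?thesis by (simp add: g_def f_def x_def y_def w_def algebra_simps)
    qed
    have s: "(\<lambda>n. (cmod (jacobi_op J u n))\<^sup>2) summable_on UNIV"
      by (rule summable_on_comparison_test[OF g]) (auto intro: le)
    have "(\<Sum>\<^sub>\<infinity>n. (cmod (jacobi_op J u n))\<^sup>2) \<le> infsum g UNIV"
      by (intro infsum_mono s g le)
    also have "\<dots> = 3 * M\<^sup>2 * (\<Sum>\<^sub>\<infinity>n. f (n + 1) + f (n - 1) + f n)"
      unfolding g_def by (intro infsum_cmult_right summable_on_add f f1 f2)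
    also have "(\<Sum>\<^sub>\<infinity>n. f (n + 1) + f (n - 1) + f n) = 3 * infsum f UNIV"
      using infsum_add[OF summable_on_add[OF f1 f2] f] infsum_add[OF f1 f2] i1 i2 by simp
    finally have "(\<Sum>\<^sub>\<infinity>n. (cmod (jacobi_op J u n))\<^sup>2) \<le> (3 * M)\<^sup>2 * infsum f UNIV"
      by (simp add: power_mult_distrib)
    then have "ell2_norm (jacobi_op J u) \<le> sqrt ((3 * M)\<^sup>2 * infsum f UNIV)"
      unfolding ell2_norm_def by (rule real_sqrt_le_mono)
    also have "\<dots> = (3 * M) * ell2_norm u"
      using M(1) by (simp add: real_sqrt_mult ell2_norm_def f_def[abs_def])
    finally show ?thesis using s by (simp add: ell2_def)
  qed
  then show ?thesis by blast
qed

lemma ell2_shift: "u \<in> ell2 \<Longrightarrow> (\<lambda>n. u (n + k)) \<in> ell2"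
  using summable_on_int_shift[of "\<lambda>n. (cmod (u n))\<^sup>2" k] by (simp add: ell2_def)

lemma ell2_weighted_product_summable:
  assumes "u \<in> ell2" "v \<in> ell2" "\<And>n. \<bar>c n\<bar> \<le> M"
  shows "(\<lambda>n. of_real (c n) * (cnj (u n) * v n)) summable_on UNIV"
proof -
  have "(\<lambda>n. M * ((cmod (u n))\<^sup>2 + (cmod (v n))\<^sup>2)) summable_on UNIV"
    using assms by (intro summable_on_cmult_right summable_on_add) (auto simp: ell2_def)
  moreover have "cmod (of_real (c n) * (cnj (u n) * v n)) \<le> M * ((cmod (u n))\<^sup>2 + (cmod (v n))\<^sup>2)" for n
  proof -
    have "cmod (u n) * cmod (v n) \<le> (cmod (u n))\<^sup>2 + (cmod (v n))\<^sup>2"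
      using sum_squares_bound[of "cmod (u n)" "cmod (v n)"]
        mult_nonneg_nonneg[OF norm_ge_zero norm_ge_zero, of "u n" "v n"] by linarith
    then show ?thesis
      using assms(3)[of n] by (auto simp: norm_mult intro!: mult_mono)
  qed
  ultimately have "(\<lambda>n. norm (of_real (c n) * (cnj (u n) * v n))) summable_on UNIV"
    by (rule summable_on_comparison_test) auto
  then show ?thesis by (rule abs_summable_summable)
qed

lemma jacobi_op_symmetric:
  assumes "J \<in> jacobi_matrices" "u \<in> ell2" "v \<in> ell2"
  shows "ell2_inner u (jacobi_op J v) = ell2_inner (jacobi_op J u) v"
proof -
  obtain a b M where J: "J = (a, b)" and M: "\<And>n. \<bar>a n\<bar> \<le> M" "\<And>n. \<bar>b n\<bar> \<le> M"
    using assms(1) by (blast elim: jacobi_matricesE)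
  define p where "p n = of_real (a n) * (cnj (u n) * v (n + 1))" for n
  define q where "q n = of_real (a n) * (cnj (u (n + 1)) * v n)" for n
  define r where "r n = of_real (b n) * (cnj (u n) * v n)" for n
  have p: "p summable_on UNIV" and q: "q summable_on UNIV" and r: "r summable_on UNIV"
    unfolding p_def q_def r_def
    by (intro ell2_weighted_product_summable[where M = M] ell2_shift assms(2,3) M)+
  have p': "(\<lambda>n. p (n - 1)) summable_on UNIV" and q': "(\<lambda>n. q (n - 1)) summable_on UNIV"
    using p q summable_on_int_shift[of p "- 1"] summable_on_int_shift[of q "- 1"] by simp_all
  have ip: "(\<Sum>\<^sub>\<infinity>n. p (n - 1)) = infsum p UNIV" and iq: "(\<Sum>\<^sub>\<infinity>n. q (n - 1)) = infsum q UNIV"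
    using infsum_int_shift[of p "- 1"] infsum_int_shift[of q "- 1"] by simp_all
  have "ell2_inner u (jacobi_op J v) = (\<Sum>\<^sub>\<infinity>n. p n + q (n - 1) + r n)"
    unfolding ell2_inner_def
    by (intro infsum_cong) (simp add: J jacobi_op_def p_def q_def r_def algebra_simps)
  also have "\<dots> = infsum p UNIV + infsum q UNIV + infsum r UNIV"
    using infsum_add[OF summable_on_add[OF p q'] r] infsum_add[OF p q'] iq by simp
  also have "\<dots> = (\<Sum>\<^sub>\<infinity>n. q n + p (n - 1) + r n)"
    using infsum_add[OF summable_on_add[OF q p'] r] infsum_add[OF q p'] ip by simp
  also have "\<dots> = ell2_inner (jacobi_op J u) v"
    unfolding ell2_inner_def
    by (intro infsum_cong) (simp add: J jacobi_op_def p_def q_def r_def algebra_simps)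
  finally show ?thesis .
qed

end

theory Submission
  imports Defs "HOL-Probability.Probability" "HOL-Computational_Algebra.Polynomial"
begin

text \<open>Put \<open>J = (a, b)\<close>. For large \<open>r\<close> there is \<open>\<kappa> = \<kappa>(r)\<close>, with \<open>\<kappa>\<close> tending to minus infinity, and a
  factorization \<open>J - \<kappa> = L L\<^sup>*\<close> with \<open>L\<close> lower bidiagonal and squared diagonal entry \<open>r\<close> at the
  site \<open>0\<close>. The commuted matrices \<open>J\<^sub>r = L\<^sup>* L + \<kappa>\<close> are again Jacobi matrices, satisfy
  \<open>(J\<^sub>r - z)\<^sup>-\<^sup>1 = L\<^sup>* (J - \<kappa>)\<^sup>-\<^sup>1 (J - z)\<^sup>-\<^sup>1 L\<close>, so that their spectra stay in \<open>K\<close>, and their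
  coefficients converge uniformly to those of \<open>J\<close>. Their \<open>H\<close> functions are
  \<open>(z - \<kappa>) r (1 / (r - q\<^sub>+) - 1 / (r - q\<^sub>-))\<close>, where \<open>q\<^sub>+\<close> and \<open>q\<^sub>-\<close> depend on \<open>J\<close> and \<open>z\<close>
  only and lie in the closed upper and lower half plane respectively. Since \<open>\<integral> \<bar>Im (1 / (r - q))\<bar> dr \<le> \<pi>\<close> for
  every \<open>q\<close>, the average over \<open>r\<close> of the measures associated with \<open>J\<^sub>r\<close> gives an interval of length
  \<open>e\<close> mass of order \<open>e\<close>. Hence it does not charge the null set \<open>K\<close>, and almost every \<open>r\<close> is good.\<close>

section \<open>The Hausdorff moment problem\<close>

text \<open>As |K| = 0, the spectrum has no room to move, so J may only be changed by operations
  that create no new spectrum; exchanging the factors of J - \<kappa> is one. The change is small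
  because L is sqrt r times the identity plus a term of order 1 / sqrt r, so that L and its adjoint
  commute up to order 1 / r. The parameter is r and not \<kappa>: the poles q+ and q- in the formula
  for H must not depend on the integration variable, while \<kappa> enters only through a bounded
  factor. For this reason L and \<kappa> come from one fixed point problem with r prescribed. Two
  obstacles shape the rest. Entries a(n) may vanish, so solutions cannot be continued along the line
  by the recursion; everything is read off the column u of the resolvent, whose entry at 0 never
  vanishes. And the factorization and the measure are merely chosen for each r, with no
  measurability in r, so the average is never formed: explicit Borel majorants of the mass of K are
  integrated instead.\<close>

lemma choose_ratio_bound:
  fixes j k n :: nat
  assumes "k \<le> n" "2 * j \<le> n" "0 < n"
  shows "\<bar>real (k choose j) / real (n choose j) - (real k / real n) ^ j\<bar> \<le> 2 * real j ^ 2 / real n"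
proof -
  have r: "real (k choose j) / real (n choose j) = (\<Prod>i<j. (real k - real i) / (real n - real i))"
  proof -
    have "real (n choose j) = (\<Prod>i<j. (real n - real i) / (real j - real i))"
      "real (k choose j) = (\<Prod>i<j. (real k - real i) / (real j - real i))"
      unfolding binomial_gbinomial gbinomial_altdef_of_nat by (simp_all add: atLeast0LessThan of_nat_diff)
    moreover have "(\<Prod>i<j. (real j - real i)) \<noteq> 0" by auto
    ultimately show ?thesis by (simp add: prod_dividef)
  qed
  \<comment> \<open>Telescoping over the factors, all of modulus at most 1. The hypothesis 2 j \<le>
    n enters twice: it gives |k - i| \<le> n - i even when k < i, and it keeps the denominators n -
    i above n / 2.\<close>
  have "\<bar>(\<Prod>i<j. (real k - real i) / (real n - real i)) - (\<Prod>i<j. real k / real n)\<bar>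
      \<le> (\<Sum>i<j. \<bar>(real k - real i) / (real n - real i) - real k / real n\<bar>)"
  proof (subst (1 2) real_norm_def[symmetric], rule norm_prod_diff)
    fix i assume "i \<in> {..<j}"
    then show "norm ((real k - real i) / (real n - real i)) \<le> 1"
      using assms by (auto simp: abs_le_iff divide_simps)
  next
    show "norm (real k / real n) \<le> 1" using assms by simp
  qed
  also have "\<dots> \<le> (\<Sum>i<j. 2 * real j / real n)"
  proof (rule sum_mono)
    fix i assume i: "i \<in> {..<j}"
    have "(real k - real i) / (real n - real i) - real k / real n = - (real i * (real n - real k) / ((real n - real i) * real n))"
      using assms i by (simp add: field_simps)
    then have "\<bar>(real k - real i) / (real n - real i) - real k / real n\<bar> = real i * (real n - real k) / ((real n - real i) * real n)"
      using assms i by simp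
    also have "\<dots> \<le> (real j * real n) / ((real n / 2) * real n)"
      using assms i by (intro frac_le mult_mono mult_pos_pos mult_right_mono) auto
    also have "\<dots> = 2 * real j / real n" using assms by simp
    finally show "\<bar>(real k - real i) / (real n - real i) - real k / real n\<bar> \<le> 2 * real j / real n" .
  qed
  finally show ?thesis by (simp add: r power2_eq_square mult.left_commute)
qed

text \<open>With x + y = 1 this evaluates the factorial moments of the Bernstein weights exactly;
  the ordinary moments then differ only by the error in \<open>choose_ratio_bound\<close>. The
  reason is (n choose k) (k choose j) = (n choose j) (n - j choose k - j), followed by the binomial
  theorem.\<close>

lemma bernstein_moment_identity:
  fixes x y :: "'a::comm_semiring_1"
  assumes "j \<le> n"
  shows "(\<Sum>k\<le>n. of_nat ((n choose k) * (k choose j)) * (x ^ k * y ^ (n - k)))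
    = of_nat (n choose j) * x ^ j * (x + y) ^ (n - j)"
proof -
  have "(\<Sum>k\<le>n. of_nat ((n choose k) * (k choose j)) * (x ^ k * y ^ (n - k)))
      = (\<Sum>k\<in>{j..n}. of_nat ((n choose k) * (k choose j)) * (x ^ k * y ^ (n - k)))"
    by (intro sum.mono_neutral_right) (auto simp: binomial_eq_0)
  also have "\<dots> = (\<Sum>k\<in>{0 + j..(n - j) + j}. of_nat ((n choose k) * (k choose j)) * (x ^ k * y ^ (n - k)))"
    using assms by simp
  also have "\<dots> = (\<Sum>i\<in>{0..n - j}. of_nat ((n choose (i + j)) * ((i + j) choose j)) * (x ^ (i + j) * y ^ (n - (i + j))))"
    by (rule sum.shift_bounds_cl_nat_ivl)
  also have "\<dots> = (\<Sum>i\<in>{0..n - j}. of_nat (n choose j) * x ^ j * (of_nat ((n - j) choose i) * x ^ i * y ^ (n - j - i)))"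
  proof (rule sum.cong)
    fix i assume "i \<in> {0..n - j}"
    then have "(n choose (i + j)) * ((i + j) choose j) = (n choose j) * ((n - j) choose i)"
      using choose_mult[of j "i + j" n] assms by simp
    then show "of_nat ((n choose (i + j)) * ((i + j) choose j)) * (x ^ (i + j) * y ^ (n - (i + j)))
      = of_nat (n choose j) * x ^ j * (of_nat ((n - j) choose i) * x ^ i * y ^ (n - j - i))"
      by (simp add: power_add ac_simps diff_diff_left add.commute)
  qed simp
  also have "\<dots> = of_nat (n choose j) * x ^ j * (x + y) ^ (n - j)"
    by (simp add: binomial_ring sum_distrib_left atMost_atLeast0)
  finally show ?thesis .
qed

text \<open>The values of \<open>\<Lambda>\<close> on the Bernstein polynomials of degree n are
  nonnegative masses, placed at the points k / n. Their moments tend to those of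
  \<open>\<Lambda>\<close>, and a weak limit along a subsequence is the measure. All masses sit in
  [0, 1], so none escapes.\<close>

theorem hausdorff_moment_functional:
  fixes \<Lambda> :: "real poly \<Rightarrow> real"
  assumes add: "\<And>p q. \<Lambda> (p + q) = \<Lambda> p + \<Lambda> q"
    and smult: "\<And>c p. \<Lambda> (smult c p) = c * \<Lambda> p"
    and pos: "\<And>i j. 0 \<le> \<Lambda> ([:0, 1:] ^ i * [:1, -1:] ^ j)"
  shows "\<exists>\<mu>::real measure. sets \<mu> = sets borel \<and> finite_measure \<mu> \<and> emeasure \<mu> (- {0..1}) = 0 \<and>
    (\<forall>p. \<Lambda> p = (\<integral>x. poly p x \<partial>\<mu>))"
proof -
  define w where "w n k = real (n choose k) * \<Lambda> ([:0, 1:] ^ k * [:1, -1:] ^ (n - k))" for n k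
  have w0: "0 \<le> w n k" for n k unfolding w_def by (intro mult_nonneg_nonneg pos) auto
  have zero: "\<Lambda> 0 = 0" using smult[of 0 0] by simp
  have sum: "\<Lambda> (\<Sum>i\<in>I. f i) = (\<Sum>i\<in>I. \<Lambda> (f i))" for I :: "nat set" and f
    by (induction I rule: infinite_finite_induct) (auto simp: zero add)
  have wj: "(\<Sum>k\<le>n. w n k * (real (k choose j) / real (n choose j))) = \<Lambda> ([:0, 1:] ^ j)" if "j \<le> n" for n j
  proof -
    have "(\<Sum>k\<le>n. w n k * real (k choose j)) = \<Lambda> (\<Sum>k\<le>n. smult (real ((n choose k) * (k choose j))) ([:0, 1:] ^ k * [:1, -1:] ^ (n - k)))"
      by (simp add: sum smult w_def mult_ac)
    also have "(\<Sum>k\<le>n. smult (real ((n choose k) * (k choose j))) ([:0, 1:] ^ k * [:1, -1:] ^ (n - k)))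
      = (\<Sum>k\<le>n. of_nat ((n choose k) * (k choose j)) * ([:0, 1:] ^ k * [:1, -1:] ^ (n - k)) :: real poly)"
      by (simp add: of_nat_poly)
    also have "\<dots> = of_nat (n choose j) * [:0, 1:] ^ j * ([:0, 1:] + [:1, -1:]) ^ (n - j)"
      using that by (rule bernstein_moment_identity)
    also have "[:0, 1:] + [:1, -1:] = (1 :: real poly)" by (simp add: one_pCons)
    also have "of_nat (n choose j) * [:0, 1:] ^ j * 1 ^ (n - j) = smult (real (n choose j)) ([:0, 1:] ^ j)"
      by (simp add: of_nat_poly)
    finally have "(\<Sum>k\<le>n. w n k * real (k choose j)) = real (n choose j) * \<Lambda> ([:0, 1:] ^ j)" by (simp add: smult)
    then have "\<Lambda> ([:0, 1:] ^ j) = (\<Sum>k\<le>n. w n k * real (k choose j)) / real (n choose j)"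
      using that by simp
    then show ?thesis by (simp add: sum_divide_distrib)
  qed
  have w1: "(\<Sum>k\<le>n. w n k) = \<Lambda> 1" for n
    using wj[of 0 n] by (simp add: one_pCons)
  have pol: "\<Lambda> p = (\<Sum>i\<le>degree p. coeff p i * \<Lambda> ([:0, 1:] ^ i))" for p
  proof -
    have "p = (\<Sum>i\<le>degree p. smult (coeff p i) ([:0, 1:] ^ i))"
      by (subst poly_as_sum_of_monoms[symmetric]) (simp add: monom_altdef)
    then have "\<Lambda> p = \<Lambda> (\<Sum>i\<le>degree p. smult (coeff p i) ([:0, 1:] ^ i))" by simp
    then show ?thesis by (simp add: sum smult)
  qed
  have m0: "0 \<le> \<Lambda> 1" using pos[of 0 0] by simp
  show ?thesis
  proof (cases "\<Lambda> 1 = 0")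
    \<comment> \<open>Here the masses cannot be normalized to probability measures; being
      nonnegative with sum \<open>\<Lambda> 1\<close>, they all vanish.\<close>
    case True
    have "\<Lambda> ([:0, 1:] ^ j) = 0" for j
    proof -
      have "\<forall>k\<in>{..j}. w j k = 0"
        using w1[of j] True w0 sum_nonneg_eq_0_iff[of "{..j}" "w j"] by simp
      then show ?thesis using wj[of j j] by simp
    qed
    then have "\<Lambda> p = 0" for p by (subst pol) simp
    then show ?thesis by (intro exI[of _ "null_measure borel"]) (auto intro!: finite_measureI)
  next
    case False
    then have m0: "0 < \<Lambda> 1" using m0 by simp
    define P where "P n = point_measure {..n} (\<lambda>k. ennreal (w n k / \<Lambda> 1))" for n
    define \<mu> where "\<mu> n = distr (P n) borel (\<lambda>k. real k / real n)" for n
    have meas: "g \<in> measurable (P n) borel" for g :: "nat \<Rightarrow> real" and n by (simp add: P_def)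
    have sp: "space (P n) = {..n}" for n by (simp add: P_def space_point_measure)
    have P: "prob_space (P n)" for n
    proof (rule prob_spaceI)
      have "emeasure (P n) (space (P n)) = (\<Sum>k\<le>n. ennreal (w n k / \<Lambda> 1))"
        by (simp add: sp, simp add: P_def emeasure_point_measure_finite)
      also have "\<dots> = ennreal (\<Sum>k\<le>n. w n k / \<Lambda> 1)" using w0 m0 by (intro sum_ennreal) auto
      also have "(\<Sum>k\<le>n. w n k / \<Lambda> 1) = 1" using w1[of n] m0 by (simp add: sum_divide_distrib[symmetric])
      finally show "emeasure (P n) (space (P n)) = 1" by simp
    qed
    have rd: "real_distribution (\<mu> n)" for n
      unfolding \<mu>_def using P meas by (intro prob_space.real_distribution_distr)
    have int: "(\<integral>x. f x \<partial>\<mu> n) = (\<Sum>k\<le>n. w n k / \<Lambda> 1 * f (real k / real n))"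
      if "f \<in> borel_measurable borel" for f :: "real \<Rightarrow> real" and n
      unfolding \<mu>_def using that meas
      by (subst integral_distr) (auto simp: P_def lebesgue_integral_point_measure_finite w0 m0 less_imp_le)
    have "tight \<mu>"
      unfolding tight_def
    proof (intro conjI allI impI rd)
      fix \<epsilon> :: real assume "0 < \<epsilon>"
      \<comment> \<open>The intervals in \<open>tight\<close> are open on the left, so -1 is taken
        instead of 0 to keep the point 0.\<close>
      have "measure (\<mu> n) {-1<..1} = 1" for n
      proof -
        have "measure (\<mu> n) {-1<..1} = measure (P n) ((\<lambda>k. real k / real n) -` {-1<..1} \<inter> space (P n))"
          unfolding \<mu>_def using meas by (subst measure_distr) auto
        also have "(\<lambda>k. real k / real n) -` {-1<..1} \<inter> space (P n) = space (P n)"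
          by (auto simp: sp divide_simps)
        finally show ?thesis using P by (simp add: prob_space.prob_space)
      qed
      then show "\<exists>a b. a < b \<and> (\<forall>n. 1 - \<epsilon> < measure (\<mu> n) {a<..b})"
        using \<open>0 < \<epsilon>\<close> by (intro exI[of _ "-1"] exI[of _ 1]) auto
    qed
    from tight_imp_convergent_subsubsequence[OF this strict_mono_id]
    obtain r M where r: "strict_mono (r :: nat \<Rightarrow> nat)" and M: "real_distribution M" and wc: "weak_conv_m (\<mu> \<circ> r) M"
      by (auto simp: comp_def id_def)
    interpret M: real_distribution M by fact
    have lim: "(\<lambda>n. integral\<^sup>L (\<mu> (r n)) f) \<longlonglongrightarrow> integral\<^sup>L M f"
      if "continuous_on UNIV f" "\<And>x. \<bar>f x\<bar> \<le> B" for f :: "real \<Rightarrow> real" and B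
    proof -
      have "weak_conv_m (\<lambda>n. \<mu> (r n)) M" using wc by (simp add: comp_def)
      then show ?thesis
        using rd M that
        by (intro weak_conv_imp_integral_bdd_continuous_conv[where B = B])
          (auto simp: continuous_on_eq_continuous_at)
    qed
    \<comment> \<open>Weak convergence needs bounded continuous test functions on the whole line;
      clamping the argument to [0, 1] turns the powers into such functions without changing them on
      the supports.\<close>
    define cl where "cl x = max 0 (min 1 x)" for x :: real
    have clc: "continuous_on UNIV cl" unfolding cl_def by (intro continuous_intros)
    have [measurable]: "cl \<in> borel_measurable borel" unfolding cl_def by measurable
    have cl_id: "cl x = x" if "x \<in> {0..1}" for x using that by (auto simp: cl_def)
    have cl01: "0 \<le> cl x" "cl x \<le> 1" for x by (auto simp: cl_def)
    have kn: "real k / real n \<in> {0..1}" if "k \<le> n" for k n using that by (auto simp: divide_simps)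
    have mom: "(\<integral>x. cl x ^ j \<partial>M) = \<Lambda> ([:0, 1:] ^ j) / \<Lambda> 1" for j
    proof -
      have "(\<lambda>n. integral\<^sup>L (\<mu> (r n)) (\<lambda>x. cl x ^ j)) \<longlonglongrightarrow> (\<integral>x. cl x ^ j \<partial>M)"
        using cl01 by (intro lim[of _ 1] continuous_intros continuous_on_compose2[OF clc]) (auto simp: abs_le_iff intro!: power_le_one order.trans[OF _ zero_le_power])
      moreover have "(\<lambda>n. integral\<^sup>L (\<mu> n) (\<lambda>x. cl x ^ j)) \<longlonglongrightarrow> \<Lambda> ([:0, 1:] ^ j) / \<Lambda> 1"
      proof (rule LIM_zero_cancel, rule Lim_null_comparison)
        show "(\<lambda>n. 2 * real j ^ 2 / real n) \<longlonglongrightarrow> 0" by (rule lim_const_over_n)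
        show "\<forall>\<^sub>F n in sequentially. norm (integral\<^sup>L (\<mu> n) (\<lambda>x. cl x ^ j) - \<Lambda> ([:0, 1:] ^ j) / \<Lambda> 1) \<le> 2 * real j ^ 2 / real n"
          using eventually_ge_at_top[of "2 * j + 1"]
        proof eventually_elim
          case (elim n)
          have "integral\<^sup>L (\<mu> n) (\<lambda>x. cl x ^ j) - \<Lambda> ([:0, 1:] ^ j) / \<Lambda> 1
            = (\<Sum>k\<le>n. w n k / \<Lambda> 1 * (real k / real n) ^ j) - (\<Sum>k\<le>n. w n k * (real (k choose j) / real (n choose j))) / \<Lambda> 1"
            using elim wj[of j n] by (subst int) (auto simp: cl_id[OF kn] intro!: sum.cong)
          also have "\<dots> = (\<Sum>k\<le>n. w n k / \<Lambda> 1 * ((real k / real n) ^ j - real (k choose j) / real (n choose j)))"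
            by (simp add: sum_divide_distrib sum_subtractf algebra_simps)
          also have "norm \<dots> \<le> (\<Sum>k\<le>n. w n k / \<Lambda> 1 * (2 * real j ^ 2 / real n))"
            unfolding real_norm_def
          proof (rule order.trans[OF sum_abs sum_mono])
            fix k assume "k \<in> {..n}"
            then show "\<bar>w n k / \<Lambda> 1 * ((real k / real n) ^ j - real (k choose j) / real (n choose j))\<bar> \<le> w n k / \<Lambda> 1 * (2 * real j ^ 2 / real n)"
              using choose_ratio_bound[of k n j] elim w0[of n k] m0
              by (subst abs_mult, intro mult_mono) (auto simp: abs_minus_commute)
          qed
          also have "\<dots> = 2 * real j ^ 2 / real n"
            using w1[of n] m0 by (simp add: sum_distrib_right[symmetric] sum_divide_distrib[symmetric])
          finally show ?case .
        qed
      qed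
      then have "(\<lambda>n. integral\<^sup>L (\<mu> (r n)) (\<lambda>x. cl x ^ j)) \<longlonglongrightarrow> \<Lambda> ([:0, 1:] ^ j) / \<Lambda> 1"
        using LIMSEQ_subseq_LIMSEQ[OF _ r] by (auto simp: comp_def)
      ultimately show ?thesis by (rule LIMSEQ_unique)
    qed
    have supp: "AE x in M. x \<in> {0..1}"
    proof -
      \<comment> \<open>A bounded continuous function that vanishes exactly on [0, 1]; its integrals
        against the discrete measures are 0, hence so is the limit.\<close>
      define f where "f x = min 1 \<bar>x - cl x\<bar>" for x :: real
      have fc: "continuous_on UNIV f" unfolding f_def by (intro continuous_intros clc)
      have [measurable]: "f \<in> borel_measurable borel" unfolding f_def by measurable
      have "(\<lambda>n. integral\<^sup>L (\<mu> (r n)) f) \<longlonglongrightarrow> integral\<^sup>L M f"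
        by (rule lim[of _ 1, OF fc]) (auto simp: f_def)
      moreover have "integral\<^sup>L (\<mu> n) f = 0" for n
        by (subst int) (auto simp: f_def cl_id[OF kn])
      ultimately have "integral\<^sup>L M f = 0" by (simp add: LIMSEQ_const_iff)
      moreover have "integrable M f"
        by (rule M.integrable_const_bound[where B = 1]) (auto simp: f_def)
      ultimately have "AE x in M. f x = 0"
        by (subst (asm) integral_nonneg_eq_0_iff_AE) (auto simp: f_def)
      then show ?thesis
        by eventually_elim (auto simp: f_def cl_def max_def min_def split: if_splits)
    qed
    define \<rho> where "\<rho> = density M (\<lambda>_. ennreal (\<Lambda> 1))"
    have "finite_measure \<rho>"
      by (rule finite_measureI) (simp add: \<rho>_def emeasure_density_const ennreal_mult_eq_top_iff)
    moreover have "emeasure \<rho> (- {0..1}) = 0"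
    proof -
      have "emeasure M (- {0..1}) = 0" using supp by (subst AE_iff_measurable[symmetric, where P = "\<lambda>x. x \<in> {0..1}"]) auto
      then show ?thesis by (simp add: \<rho>_def emeasure_density_const)
    qed
    moreover have "\<Lambda> p = (\<integral>x. poly p x \<partial>\<rho>)" for p
    proof -
      have [measurable]: "(\<lambda>x. poly p x) \<in> borel_measurable borel"
        by (intro borel_measurable_continuous_onI continuous_intros)
      have "(\<integral>x. poly p x \<partial>\<rho>) = \<Lambda> 1 * (\<integral>x. poly p x \<partial>M)"
        unfolding \<rho>_def using m0
        by (subst integral_density) auto
      also have "(\<integral>x. poly p x \<partial>M) = (\<integral>x. (\<Sum>i\<le>degree p. coeff p i * cl x ^ i) \<partial>M)"
      proof (rule integral_cong_AE)
        show "AE x in M. poly p x = (\<Sum>i\<le>degree p. coeff p i * cl x ^ i)"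
          using supp by eventually_elim (simp add: poly_altdef cl_id)
      qed (auto intro!: borel_measurable_continuous_onI continuous_intros)
      also have "\<dots> = (\<Sum>i\<le>degree p. coeff p i * (\<integral>x. cl x ^ i \<partial>M))"
      proof -
        have "integrable M (\<lambda>x. cl x ^ i)" for i
          by (rule M.integrable_const_bound[where B = 1]) (auto simp: cl01 power_le_one)
        then show ?thesis by simp
      qed
      also have "\<Lambda> 1 * \<dots> = \<Lambda> p"
        by (subst (2) pol) (use m0 in \<open>simp add: mom sum_distrib_left\<close>)
      finally show ?thesis by simp
    qed
    moreover have "sets \<rho> = sets borel" by (simp add: \<rho>_def)
    ultimately show ?thesis by blast
  qed
qed

section \<open>Spectral measures of bounded symmetric operators\<close>

definition poly_op :: "('a::real_vector \<Rightarrow> 'a) \<Rightarrow> real poly \<Rightarrow> 'a \<Rightarrow> 'a" where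
  "poly_op T p = fold_coeffs (\<lambda>c F v. c *\<^sub>R v + T (F v)) p (\<lambda>v. 0)"

lemma poly_op_0 [simp]: "poly_op T 0 v = 0"
  by (simp add: poly_op_def)

lemma poly_op_pCons [simp]:
  assumes "linear T"
  shows "poly_op T (pCons c p) v = c *\<^sub>R v + T (poly_op T p v)"
  using linear_0[OF assms] by (cases "p = 0 \<and> c = 0") (auto simp: poly_op_def fun_eq_iff)

lemma poly_op_add:
  assumes "linear T"
  shows "poly_op T (p + q) v = poly_op T p v + poly_op T q v"
  by (induction p q rule: poly_induct2) (simp_all add: assms linear_add algebra_simps)

lemma poly_op_smult:
  assumes "linear T"
  shows "poly_op T (smult c p) v = c *\<^sub>R poly_op T p v"
  by (induction p) (simp_all add: assms linear_scale algebra_simps)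

lemma poly_op_mult:
  assumes "linear T"
  shows "poly_op T (p * q) v = poly_op T p (poly_op T q v)"
  by (induction p) (simp_all add: assms poly_op_add poly_op_smult)

lemma poly_op_diff_right:
  assumes "linear T"
  shows "poly_op T p (u - w) = poly_op T p u - poly_op T p w"
  by (induction p) (simp_all add: assms linear_diff scaleR_diff_right)

lemma poly_op_symmetric:
  fixes T :: "'a::real_inner \<Rightarrow> 'a"
  assumes "linear T" and sym: "\<And>u w. inner (T u) w = inner u (T w)"
  shows "inner (poly_op T p u) w = inner u (poly_op T p w)"
proof -
  have comm: "poly_op T p (T w) = T (poly_op T p w)" for p w
    using poly_op_mult[OF assms(1), of "[:0, 1:]" p w] poly_op_mult[OF assms(1), of p "[:0, 1:]" w] 
    by (simp add: assms(1) mult.commute linear_0)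
  show ?thesis
    by (induction p arbitrary: w) (simp_all add: assms inner_add_left inner_add_right sym comm)
qed

lemma poly_op_even_power_nonneg:
  fixes T :: "'a::real_inner \<Rightarrow> 'a"
  assumes "linear T" and sym: "\<And>u w. inner (T u) w = inner u (T w)"
    and "\<And>u. 0 \<le> inner u (poly_op T p u)"
  shows "0 \<le> inner v (poly_op T (p * q ^ 2) v)"
proof -
  have "inner v (poly_op T (p * q ^ 2) v) = inner (poly_op T q v) (poly_op T p (poly_op T q v))"
    by (simp add: power2_eq_square mult.left_commute[of p q] poly_op_mult poly_op_symmetric assms)
  then show ?thesis using assms(3) by simp
qed

text \<open>Supplies the positivity demanded by \<open>hausdorff_moment_functional\<close>. Squares
  can be pulled out of p^i (1 - p)^j, so only the parities of i and j matter.\<close>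

lemma poly_op_contraction_nonneg:
  fixes T :: "'a::real_inner \<Rightarrow> 'a"
  assumes T: "linear T" and sym: "\<And>u w. inner (T u) w = inner u (T w)"
    and p: "\<And>u. 0 \<le> inner u (poly_op T p u)" and q: "\<And>u. 0 \<le> inner u (poly_op T (1 - p) u)"
  shows "0 \<le> inner v (poly_op T (p ^ i * (1 - p) ^ j) v)"
proof -
  have one: "0 \<le> inner u (poly_op T 1 u)" for u by (simp add: one_pCons T linear_0)
  \<comment> \<open>\<open>p (1 - p) = p (1 - p)\<^sup>2 + (1 - p) p\<^sup>2\<close> reduces the odd-odd case to the other ones.\<close>
  have pq: "0 \<le> inner u (poly_op T (p * (1 - p)) u)" for u
  proof -
    have "p * (1 - p) = p * (1 - p) ^ 2 + (1 - p) * p ^ 2" by algebra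
    then show ?thesis
      using poly_op_even_power_nonneg[of T p u "1 - p"] poly_op_even_power_nonneg[of T "1 - p" u p] assms
      by (simp add: poly_op_add inner_add_right)
  qed
  define r where "r = (if even i then 1 else p) * (if even j then 1 else 1 - p)"
  have "0 \<le> inner u (poly_op T r u)" for u
    using one p q pq by (simp add: r_def)
  moreover have "p ^ i * (1 - p) ^ j = r * (p ^ (i div 2) * (1 - p) ^ (j div 2)) ^ 2"
  proof -
    have sq: "s ^ k = (if even k then 1 else s) * (s ^ (k div 2)) ^ 2" for s :: "real poly" and k
      by (cases "even k") (auto elim!: evenE oddE simp: power_mult[symmetric] mult.commute)
    show ?thesis unfolding r_def by (subst sq[of p i], subst sq[of "1 - p" j]) (simp only: power_mult_distrib mult_ac)
  qed
  ultimately show ?thesis using poly_op_even_power_nonneg[OF T sym] by simp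
qed

text \<open>The quadratic form of T / R lies between -1 and 1, so that of X = (1 + T / R) / 2 lies
  between 0 and 1. The moment theorem for the functional sending p to <v, p(X) v> gives a measure on
  [0, 1], and t \<mapsto> 2 R t - R carries it back to [-R, R].\<close>

theorem spectral_measure_exists:
  fixes T :: "'a::real_inner \<Rightarrow> 'a" and v :: 'a
  assumes T: "linear T" and sym: "\<And>u w. inner (T u) w = inner u (T w)"
    and R: "0 < R" "\<And>u. \<bar>inner u (T u)\<bar> \<le> R * inner u u"
  shows "\<exists>\<mu>::real measure. sets \<mu> = sets borel \<and> finite_measure \<mu> \<and> emeasure \<mu> (- {-R..R}) = 0 \<and>
    (\<forall>p. inner v (poly_op T p v) = (\<integral>x. poly p x \<partial>\<mu>))"
proof -
  define X :: "real poly" where "X = [:1 / 2, 1 / (2 * R):]"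
  have X: "poly_op T X u = (1 / 2) *\<^sub>R u + (1 / (2 * R)) *\<^sub>R T u" for u
    by (simp add: X_def T linear_0 linear_scale)
  have X': "poly_op T (1 - X) u = (1 / 2) *\<^sub>R u - (1 / (2 * R)) *\<^sub>R T u" for u
    by (simp add: X_def T linear_0 linear_neg linear_scale one_pCons)
  have bd: "- (R * inner u u) \<le> inner u (T u)" "inner u (T u) \<le> R * inner u u" for u
    using R(2)[of u] by (auto simp: abs_le_iff)
  have pos1: "0 \<le> inner u (poly_op T X u)" and pos2: "0 \<le> inner u (poly_op T (1 - X) u)" for u
    using bd[of u] R(1) by (auto simp: X X' inner_add_right inner_diff_right field_simps)
  define \<Lambda> where "\<Lambda> p = inner v (poly_op T (p \<circ>\<^sub>p X) v)" for p
  have "\<exists>\<mu>::real measure. sets \<mu> = sets borel \<and> finite_measure \<mu> \<and> emeasure \<mu> (- {0..1}) = 0 \<and>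
    (\<forall>p. \<Lambda> p = (\<integral>x. poly p x \<partial>\<mu>))"
  proof (rule hausdorff_moment_functional)
    fix i j :: nat
    have "p ^ n \<circ>\<^sub>p X = (p \<circ>\<^sub>p X) ^ n" for p and n :: nat
      by (induction n) (simp_all add: pcompose_mult pcompose_1)
    then have "([:0, 1:] ^ i * [:1, -1:] ^ j) \<circ>\<^sub>p X = X ^ i * (1 - X) ^ j"
      by (simp add: pcompose_mult pcompose_pCons one_pCons)
    then show "0 \<le> \<Lambda> ([:0, 1:] ^ i * [:1, -1:] ^ j)"
      unfolding \<Lambda>_def using poly_op_contraction_nonneg[OF T sym pos1 pos2] by simp
  qed (simp_all add: \<Lambda>_def pcompose_add pcompose_smult poly_op_add poly_op_smult T inner_add_right)
  then obtain \<mu> :: "real measure" where \<mu>: "sets \<mu> = sets borel" "finite_measure \<mu>" "emeasure \<mu> (- {0..1}) = 0"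
    and mom: "\<And>p. \<Lambda> p = (\<integral>x. poly p x \<partial>\<mu>)" by blast
  define \<rho> where "\<rho> = distr \<mu> borel (\<lambda>x. 2 * R * x - R)"
  have meas [measurable]: "(\<lambda>x. 2 * R * x - R) \<in> measurable \<mu> borel"
    by (simp add: measurable_cong_sets[OF \<mu>(1) refl])
  have "finite_measure \<rho>" unfolding \<rho>_def by (rule finite_measure.finite_measure_distr[OF \<mu>(2) meas])
  moreover have "emeasure \<rho> (- {-R..R}) = 0"
  proof -
    have "emeasure \<rho> (- {-R..R}) = emeasure \<mu> ((\<lambda>x. 2 * R * x - R) -` (- {-R..R}) \<inter> space \<mu>)"
      unfolding \<rho>_def by (rule emeasure_distr[OF meas]) auto
    also have "\<dots> \<le> emeasure \<mu> (- {0..1})"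
    proof (rule emeasure_mono)
      show "(\<lambda>x. 2 * R * x - R) -` (- {-R..R}) \<inter> space \<mu> \<subseteq> - {0..1}"
        using R(1) mult_left_mono[of _ 1 R] by auto
    qed (simp add: \<mu>(1))
    finally show ?thesis using \<mu>(3) by simp
  qed
  moreover have "inner v (poly_op T p v) = (\<integral>x. poly p x \<partial>\<rho>)" for p
  proof -
    have "(\<integral>x. poly p x \<partial>\<rho>) = (\<integral>x. poly p (2 * R * x - R) \<partial>\<mu>)"
      unfolding \<rho>_def by (rule integral_distr[OF meas]) (intro borel_measurable_continuous_onI continuous_intros)
    also have "\<dots> = (\<integral>x. poly (p \<circ>\<^sub>p [:-R, 2 * R:]) x \<partial>\<mu>)"
      by (simp add: poly_pcompose algebra_simps)
    also have "\<dots> = \<Lambda> (p \<circ>\<^sub>p [:-R, 2 * R:])" by (simp add: mom)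
    finally have *: "(\<integral>x. poly p x \<partial>\<rho>) = inner v (poly_op T (p \<circ>\<^sub>p [:-R, 2 * R:] \<circ>\<^sub>p X) v)"
      by (simp add: \<Lambda>_def)
    have "[:-R, 2 * R:] \<circ>\<^sub>p X = [:0, 1:]"
      using R(1) by (simp add: X_def pcompose_pCons)
    then have "p \<circ>\<^sub>p [:-R, 2 * R:] \<circ>\<^sub>p X = p"
      by (simp add: pcompose_assoc[symmetric] pcompose_idR)
    with * show ?thesis by simp
  qed
  moreover have "sets \<rho> = sets borel" by (simp add: \<rho>_def)
  ultimately show ?thesis by blast
qed

lemma real_polynomial_approx:
  fixes f :: "real \<Rightarrow> real"
  assumes "continuous_on {a..b} f" "0 < e"
  obtains p where "\<And>x. x \<in> {a..b} \<Longrightarrow> \<bar>f x - poly p x\<bar> < e"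
proof -
  obtain g where g: "real_polynomial_function g" "\<And>x. x \<in> {a..b} \<Longrightarrow> \<bar>f x - g x\<bar> < e"
    using Stone_Weierstrass_real_polynomial_function[of "{a..b}" f e] assms by auto
  obtain c n where "g = (\<lambda>x. \<Sum>i\<le>n. c i * x ^ i)"
    using g(1) real_polynomial_function_iff_sum by blast
  then have "g x = poly (\<Sum>i\<le>n. monom (c i) i) x" for x
    by (simp add: poly_sum poly_monom)
  with g(2) show ?thesis by (intro that[of "\<Sum>i\<le>n. monom (c i) i"]) auto
qed

text \<open>The vector \<open>g\<close> is ((T - x)^2 + y^2)^-1 v. This real quadratic replaces the
  resolvent, as the space is real: q = 1 and q = t - x give the imaginary part (up to the factor y)
  and the real part of the Stieltjes transform. A polynomial p close to 1 / s on [-R, R] makes s(T)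
  (g - p(T) v) small, and s(T) \<ge> y^2 then bounds g - p(T) v itself.\<close>

theorem spectral_measure_resolvent:
  fixes T :: "'a::real_inner \<Rightarrow> 'a" and v :: 'a
  assumes T: "linear T" and sym: "\<And>u w. inner (T u) w = inner u (T w)"
    and \<mu>: "sets \<mu> = sets borel" "finite_measure \<mu>" "emeasure \<mu> (- {-R..R}) = 0"
    and mom: "\<And>p. inner v (poly_op T p v) = (\<integral>x. poly p x \<partial>\<mu>)"
    and y: "y \<noteq> 0" and g: "poly_op T ([:x\<^sup>2 + y\<^sup>2, - 2 * x, 1:]) g = v"
  shows "inner v (poly_op T q g) = (\<integral>t. poly q t / ((t - x)\<^sup>2 + y\<^sup>2) \<partial>\<mu>)"
proof -
  define s where "s = [:x\<^sup>2 + y\<^sup>2, - 2 * x, 1:]"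
  have s: "poly s t = (t - x)\<^sup>2 + y\<^sup>2" for t by (simp add: s_def power2_eq_square algebra_simps)
  have spos: "0 < poly s t" for t unfolding s using y by (simp add: add_nonneg_pos)
  have s_eq: "s = [:y\<^sup>2:] + [:-x, 1:] ^ 2" by (simp add: s_def power2_eq_square)
  interpret finite_measure \<mu> by fact
  have meas: "f \<in> borel_measurable \<mu>" if "f \<in> borel_measurable borel" for f :: "real \<Rightarrow> real"
    using that by (simp add: measurable_cong_sets[OF \<mu>(1) refl])
  have supp: "AE t in \<mu>. t \<in> {-R..R}"
    using \<mu>(3) by (intro AE_I[of _ _ "- {-R..R}"]) (auto simp: \<mu>(1))
  have int: "integrable \<mu> f" if "continuous_on UNIV f" for f :: "real \<Rightarrow> real"
  proof -
    have "bounded (f ` {-R..R})"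
      by (intro compact_imp_bounded compact_continuous_image continuous_on_subset[OF that]) auto
    then obtain B where B: "\<forall>z\<in>f ` {-R..R}. norm z \<le> B"
      unfolding bounded_iff ..
    have "AE t in \<mu>. norm (f t) \<le> B" using supp by (rule eventually_mono) (use B in auto)
    then show ?thesis
      by (rule integrable_const_bound[OF _ meas[OF borel_measurable_continuous_onI[OF that]]])
  qed
  have cs: "continuous_on UNIV (\<lambda>t. poly p t / poly s t)" for p
    by (intro continuous_intros ballI) (metis spos less_irrefl)
  define m where "m = measure \<mu> (space \<mu>)"
  have nrm: "norm (poly_op T p v) ^ 2 = (\<integral>t. (poly p t)\<^sup>2 \<partial>\<mu>)" for p
  proof -
    have "norm (poly_op T p v) ^ 2 = inner v (poly_op T (p * p) v)"
      by (simp add: power2_norm_eq_inner poly_op_mult[OF T] poly_op_symmetric[OF T sym])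
    then show ?thesis by (simp add: mom power2_eq_square)
  qed
  define F where "F = inner v (poly_op T q g) - (\<integral>t. poly q t / poly s t \<partial>\<mu>)"
  define C where "C = norm (poly_op T q v) * sqrt m / y\<^sup>2 + (\<integral>t. \<bar>poly q t / poly s t\<bar> \<partial>\<mu>)"
  have F: "\<bar>F\<bar> \<le> C * e" if e: "e > 0" for e
  proof -
    obtain S where S: "\<And>t. t \<in> {-R..R} \<Longrightarrow> poly s t \<le> S" "S > 0"
    proof -
      have "bounded ((\<lambda>t. poly s t) ` {-R..R})"
        by (intro compact_imp_bounded compact_continuous_image continuous_intros) auto
      then obtain B where "\<forall>z\<in>(\<lambda>t. poly s t) ` {-R..R}. norm z \<le> B"
        unfolding bounded_iff ..
      then have "poly s t \<le> max B 1" if "t \<in> {-R..R}" for t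
        using abs_le_D1[of "poly s t" B] that by auto
      then show ?thesis using that[of "max B 1"] by simp
    qed
    obtain p where p: "\<And>t. t \<in> {-R..R} \<Longrightarrow> \<bar>1 / poly s t - poly p t\<bar> < e / S"
      using real_polynomial_approx[of "-R" R "\<lambda>t. 1 / poly s t" "e / S"] cs[of 1] e S(2)
      by (auto intro: continuous_on_subset)
    have pe: "\<bar>poly (1 - s * p) t\<bar> \<le> e" if "t \<in> {-R..R}" for t
    proof -
      have "\<bar>poly (1 - s * p) t\<bar> = poly s t * \<bar>1 / poly s t - poly p t\<bar>"
        using spos[of t] abs_mult[of "poly s t" "1 / poly s t - poly p t"] by (simp add: right_diff_distrib)
      also have "\<dots> \<le> S * (e / S)" using S p[OF that] that spos[of t] by (intro mult_mono) (auto simp: less_imp_le)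
      finally show ?thesis using S(2) by simp
    qed
    define h where "h = g - poly_op T p v"
    have sh: "poly_op T s h = poly_op T (1 - s * p) v"
    proof -
      have "poly_op T s (g - poly_op T p v) = poly_op T s g - poly_op T s (poly_op T p v)"
        by (rule poly_op_diff_right[OF T])
      also have "poly_op T s g = v" using g by (simp add: s_def)
      also have "v - poly_op T s (poly_op T p v) = poly_op T (1 - s * p) v"
        using poly_op_add[OF T, of 1 "- (s * p)" v] poly_op_smult[OF T, of "-1" "s * p" v]
        by (simp add: poly_op_mult[OF T] one_pCons T linear_0)
      finally show ?thesis by (simp add: h_def)
    qed
    have "norm (poly_op T s h) ^ 2 \<le> m * e\<^sup>2"
    proof -
      have "(\<integral>t. (poly (1 - s * p) t)\<^sup>2 \<partial>\<mu>) \<le> (\<integral>t. e\<^sup>2 \<partial>\<mu>)"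
      proof (rule integral_mono_AE)
        show "AE t in \<mu>. (poly (1 - s * p) t)\<^sup>2 \<le> e\<^sup>2"
          using supp by eventually_elim (use pe in \<open>metis abs_ge_zero power2_abs power_mono\<close>)
      qed (intro int continuous_intros)+
      then show ?thesis by (simp add: sh nrm m_def mult.commute)
    qed
    then have ns: "norm (poly_op T s h) \<le> sqrt m * e"
      using e by (metis abs_of_pos real_sqrt_abs real_sqrt_le_mono real_sqrt_mult abs_norm_cancel)
    have "y\<^sup>2 * norm h ^ 2 \<le> inner h (poly_op T s h)"
    proof -
      have "inner h (poly_op T s h) = y\<^sup>2 * inner h h + inner h (poly_op T ([:-x, 1:] * [:-x, 1:]) h)"
        unfolding s_eq power2_eq_square[of "[:-x, 1:]"] poly_op_add[OF T] by (simp add: T linear_0 inner_add_right)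
      also have "inner h (poly_op T ([:-x, 1:] * [:-x, 1:]) h) = norm (poly_op T [:-x, 1:] h) ^ 2"
        unfolding poly_op_mult[OF T] by (simp only: poly_op_symmetric[OF T sym, symmetric] power2_norm_eq_inner)
      finally show ?thesis by (simp add: power2_norm_eq_inner)
    qed
    also have "\<dots> \<le> norm h * norm (poly_op T s h)" by (rule norm_cauchy_schwarz)
    finally have nh: "y\<^sup>2 * norm h \<le> norm (poly_op T s h)"
      by (cases "norm h = 0") (auto simp: power2_eq_square[of "norm h"] mult.assoc mult.left_commute[of "norm h"])
    have "inner v (poly_op T q g) = inner (poly_op T q v) g" by (rule poly_op_symmetric[OF T sym, symmetric])
    also have "\<dots> = inner (poly_op T q v) (h + poly_op T p v)" by (simp add: h_def)
    also have "\<dots> = inner (poly_op T q v) h + (\<integral>t. poly q t * poly p t \<partial>\<mu>)"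
      by (simp add: inner_add_right poly_op_symmetric[OF T sym] mom flip: poly_op_mult[OF T])
    finally have "F = inner (poly_op T q v) h + ((\<integral>t. poly q t * poly p t \<partial>\<mu>) - (\<integral>t. poly q t / poly s t \<partial>\<mu>))"
      by (simp add: F_def)
    also have "(\<integral>t. poly q t * poly p t \<partial>\<mu>) - (\<integral>t. poly q t / poly s t \<partial>\<mu>) = (\<integral>t. poly q t * poly p t - poly q t / poly s t \<partial>\<mu>)"
      by (intro Bochner_Integration.integral_diff[symmetric] int cs continuous_intros)
    finally have "\<bar>F\<bar> \<le> \<bar>inner (poly_op T q v) h\<bar> + \<bar>\<integral>t. poly q t * poly p t - poly q t / poly s t \<partial>\<mu>\<bar>" by simp
    also have "\<bar>inner (poly_op T q v) h\<bar> \<le> norm (poly_op T q v) * sqrt m / y\<^sup>2 * e"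
    proof -
      have "norm h \<le> sqrt m * e / y\<^sup>2" using nh ns y by (simp add: field_simps)
      then show ?thesis
        using Cauchy_Schwarz_ineq2[of "poly_op T q v" h] mult_left_mono[of "norm h" "sqrt m * e / y\<^sup>2" "norm (poly_op T q v)"]
        by (simp add: mult_ac)
    qed
    also have "\<bar>\<integral>t. poly q t * poly p t - poly q t / poly s t \<partial>\<mu>\<bar> \<le> (\<integral>t. \<bar>poly q t / poly s t\<bar> * e \<partial>\<mu>)"
      unfolding real_norm_def[symmetric]
    proof (rule order.trans[OF integral_norm_bound integral_mono_AE])
      show "integrable \<mu> (\<lambda>t. norm (poly q t * poly p t - poly q t / poly s t))"
        by (intro int continuous_on_norm continuous_on_diff cs continuous_intros)
      show "integrable \<mu> (\<lambda>t. norm (poly q t / poly s t) * e)" by (intro int continuous_on_mult continuous_on_norm cs continuous_intros)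
    next
      have "norm (poly q t * poly p t - poly q t / poly s t) \<le> norm (poly q t / poly s t) * e" if "t \<in> {-R..R}" for t
      proof -
        have "poly q t * poly p t - poly q t / poly s t = - (poly q t / poly s t) * poly (1 - s * p) t"
          using spos[of t] by (simp add: field_simps)
        then have "norm (poly q t * poly p t - poly q t / poly s t) = norm (poly q t / poly s t) * \<bar>poly (1 - s * p) t\<bar>"
          by (simp only: abs_mult abs_minus_cancel real_norm_def)
        also have "\<dots> \<le> norm (poly q t / poly s t) * e" by (intro mult_left_mono pe that norm_ge_zero)
        finally show ?thesis .
      qed
      then show "AE t in \<mu>. norm (poly q t * poly p t - poly q t / poly s t) \<le> norm (poly q t / poly s t) * e"
        by (rule eventually_mono[OF supp])
    qed
    finally show ?thesis by (simp only: C_def distrib_right Bochner_Integration.integral_mult_left_zero)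
  qed
  have "\<bar>F\<bar> \<le> 0"
  proof (rule field_le_epsilon)
    fix e :: real assume "e > 0"
    have "C \<ge> 0" unfolding C_def by (intro add_nonneg_nonneg divide_nonneg_nonneg mult_nonneg_nonneg) (auto simp: m_def)
    then have "C * (e / (C + 1)) \<le> e" using \<open>e > 0\<close> by (simp add: field_simps)
    then show "\<bar>F\<bar> \<le> 0 + e" using F[of "e / (C + 1)"] \<open>e > 0\<close> \<open>C \<ge> 0\<close> by simp
  qed
  then show ?thesis by (simp add: F_def s)
qed

section \<open>Square-summable sequences and Jacobi matrices\<close>

lemma ell2_minus:
  assumes "u \<in> ell2" "v \<in> ell2"
  shows "(\<lambda>n. u n - v n) \<in> ell2"
  unfolding ell2_def mem_Collect_eq
proof (rule summable_on_comparison_test)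
  show "(\<lambda>n. 2 * ((cmod (u n))\<^sup>2 + (cmod (v n))\<^sup>2)) summable_on UNIV"
    using assms by (intro summable_on_cmult_right summable_on_add) (auto simp: ell2_def)
  fix n
  have "(cmod (u n - v n))\<^sup>2 \<le> (cmod (u n) + cmod (v n))\<^sup>2"
    by (intro power_mono norm_triangle_ineq4) auto
  also have "\<dots> \<le> 2 * ((cmod (u n))\<^sup>2 + (cmod (v n))\<^sup>2)"
    using sum_squares_bound[of "cmod (u n)" "cmod (v n)"] by (simp add: power2_sum)
  finally show "(cmod (u n - v n))\<^sup>2 \<le> 2 * ((cmod (u n))\<^sup>2 + (cmod (v n))\<^sup>2)" .
qed simp

lemma ell2_weighted:
  assumes "u \<in> ell2" "\<And>n. cmod (c n) \<le> B"
  shows "(\<lambda>n. c n * u n) \<in> ell2"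
  unfolding ell2_def mem_Collect_eq
proof (rule summable_on_comparison_test)
  show "(\<lambda>n. B\<^sup>2 * (cmod (u n))\<^sup>2) summable_on UNIV"
    using assms by (intro summable_on_cmult_right) (auto simp: ell2_def)
  show "(cmod (c n * u n))\<^sup>2 \<le> B\<^sup>2 * (cmod (u n))\<^sup>2" for n
    using assms(2)[of n] by (simp add: norm_mult power_mult_distrib mult_right_mono power_mono)
qed simp

lemma ell2_cmult: "u \<in> ell2 \<Longrightarrow> (\<lambda>n. c * u n) \<in> ell2"
  by (rule ell2_weighted[of u "\<lambda>_. c" "cmod c"]) auto

lemma ell2_bound: "u \<in> ell2 \<Longrightarrow> (\<And>n. cmod (v n) \<le> cmod (u n)) \<Longrightarrow> v \<in> ell2"
  unfolding ell2_def mem_Collect_eq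
  by (rule summable_on_comparison_test[of "\<lambda>n. (cmod (u n))\<^sup>2"]) (auto intro: power_mono)

lemma delta_in_ell2: "delta k \<in> ell2"
proof -
  have "(\<lambda>n. (cmod (delta k n))\<^sup>2) summable_on {k}" by simp
  also have "?this \<longleftrightarrow> (\<lambda>n. (cmod (delta k n))\<^sup>2) summable_on UNIV"
    by (rule summable_on_cong_neutral) (auto simp: delta_def)
  finally show ?thesis by (simp add: ell2_def)
qed

lemma ell2_inner_delta: "ell2_inner (delta k) u = u k"
proof -
  have "(\<Sum>\<^sub>\<infinity>n. cnj (delta k n) * u n) = (\<Sum>\<^sub>\<infinity>n\<in>{k}. cnj (delta k n) * u n)"
    by (rule infsum_cong_neutral) (auto simp: delta_def)
  then show ?thesis by (simp add: ell2_inner_def delta_def)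
qed

lemma jacobi_shift_in_ell2:
  "J \<in> jacobi_matrices \<Longrightarrow> u \<in> ell2 \<Longrightarrow> jacobi_shift J z u \<in> ell2"
  using jacobi_op_bounded[of J] unfolding jacobi_shift_def
  by (intro ell2_minus ell2_cmult) auto

lemma jacobi_resolvent_shift:
  assumes "z \<in> jacobi_resolvent_set J"
  shows "f \<in> ell2 \<Longrightarrow> jacobi_resolvent J z f \<in> ell2"
    and "f \<in> ell2 \<Longrightarrow> jacobi_shift J z (jacobi_resolvent J z f) = f"
    and "u \<in> ell2 \<Longrightarrow> jacobi_resolvent J z (jacobi_shift J z u) = u"
  using assms unfolding jacobi_resolvent_set_def jacobi_resolvent_def bij_betw_def
  by (auto simp: inv_into_into f_inv_into_f)

lemma ell2_tendsto_0:
  fixes f :: "nat \<Rightarrow> int"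
  assumes "u \<in> ell2" "inj f"
  shows "(\<lambda>k. u (f k)) \<longlonglongrightarrow> 0"
proof -
  have "(\<lambda>n. (cmod (u n))\<^sup>2) summable_on range f"
    using assms(1) by (auto simp: ell2_def intro: summable_on_subset_banach)
  then have "((\<lambda>n. (cmod (u n))\<^sup>2) \<circ> f) summable_on UNIV"
    by (rule summable_on_reindex[OF assms(2), THEN iffD1])
  then have "(\<lambda>k. (cmod (u (f k)))\<^sup>2) summable_on UNIV" by (simp add: comp_def)
  then have "(\<lambda>k. (cmod (u (f k)))\<^sup>2) \<longlonglongrightarrow> 0"
    by (intro summable_LIMSEQ_zero summable_on_imp_summable)
  then have "(\<lambda>k. sqrt ((cmod (u (f k)))\<^sup>2)) \<longlonglongrightarrow> sqrt 0" by (rule tendsto_real_sqrt)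
  then show ?thesis by (simp add: tendsto_norm_zero_iff)
qed

section \<open>Sign and size of the Green function column at the site 0\<close>

context
  fixes a b :: "int \<Rightarrow> real" and z :: complex and u :: "int \<Rightarrow> complex"
  assumes J: "(a, b) \<in> jacobi_matrices" and z: "Im z > 0"
    and u: "u \<in> ell2" and sol: "jacobi_shift (a, b) z u = delta 0"
begin

text \<open>Up to a constant factor, the Wronskian of \<open>u\<close> and its conjugate.\<close>

private definition W :: "int \<Rightarrow> real" where
  "W n = Im (of_real (a n) * cnj (u n) * u (n + 1))"

text \<open>Multiply the equation at n by the conjugate of u(n) and take imaginary parts: the entry
  b(n) drops out, and the two off-diagonal terms give \<open>W n\<close> and - W(n - 1).\<close>

private lemma W_step: "W n - W (n - 1) = Im z * (cmod (u n))\<^sup>2 - (if n = 0 then Im (u 0) else 0)"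
proof -
  have e: "of_real (a n) * u (n + 1) + of_real (a (n - 1)) * u (n - 1) + of_real (b n) * u n - z * u n
    = (if n = 0 then 1 else 0)"
    using fun_cong[OF sol, of n] by (simp add: jacobi_shift_def jacobi_op_def delta_def)
  have "Im (cnj (u n) * (of_real (a n) * u (n + 1) + of_real (a (n - 1)) * u (n - 1) + of_real (b n) * u n - z * u n))
    = W n - W (n - 1) - Im z * (cmod (u n))\<^sup>2"
    unfolding cmod_power2 by (simp add: W_def algebra_simps power2_eq_square)
  then show ?thesis unfolding e by (cases "n = 0") simp_all
qed

private lemma W_tendsto: "inj f \<Longrightarrow> (\<lambda>k. W (f k)) \<longlonglongrightarrow> 0" for f :: "nat \<Rightarrow> int"
proof -
  assume f: "inj f"
  obtain a' b' M where "(a, b) = (a', b')" "\<And>n. \<bar>a' n\<bar> \<le> M"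
    using jacobi_matricesE[OF J] by metis
  then have M: "\<bar>a n\<bar> \<le> M" for n by simp
  have f': "inj (\<lambda>k. f k + 1)" using f by (auto simp: inj_def)
  have "(\<lambda>k. M * (cmod (u (f k)) * cmod (u (f k + 1)))) \<longlonglongrightarrow> M * (0 * 0)"
    by (intro tendsto_mult tendsto_const tendsto_norm_zero ell2_tendsto_0 u f f')
  then have lim: "(\<lambda>k. M * (cmod (u (f k)) * cmod (u (f k + 1)))) \<longlonglongrightarrow> 0" by simp
  have "norm (W (f k)) \<le> M * (cmod (u (f k)) * cmod (u (f k + 1)))" for k
  proof -
    have "norm (W (f k)) \<le> cmod (of_real (a (f k)) * cnj (u (f k)) * u (f k + 1))"
      unfolding W_def real_norm_def by (rule abs_Im_le_cmod)
    also have "\<dots> \<le> M * (cmod (u (f k)) * cmod (u (f k + 1)))"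
      using mult_right_mono[OF M[of "f k"], of "cmod (u (f k)) * cmod (u (f k + 1))"]
      by (simp add: norm_mult mult.assoc)
    finally show ?thesis .
  qed
  then show ?thesis by (intro Lim_null_comparison[OF always_eventually lim] allI)
qed

text \<open>By \<open>W_step\<close>, passing from n - 1 to n does not decrease \<open>W\<close>
  unless n = 0, and \<open>W\<close> tends to 0 at both ends. Hence it is nonpositive from 0 on and
  nonnegative before 0.\<close>

private lemma W_right: "W 1 \<le> 0"
proof -
  have "incseq (\<lambda>k. W (int k + 1))"
  proof (rule incseq_SucI)
    fix k
    have "W (int k + 2) - W (int k + 2 - 1) \<ge> 0"
      unfolding W_step using z by (simp add: zero_le_mult_iff)
    moreover have "int k + 2 - 1 = int k + 1" "int (Suc k) + 1 = int k + 2" by simp_all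
    ultimately show "W (int k + 1) \<le> W (int (Suc k) + 1)" by (simp only: diff_ge_0_iff_ge)
  qed
  moreover have "(\<lambda>k. W (int k + 1)) \<longlonglongrightarrow> 0" by (rule W_tendsto) (auto simp: inj_def)
  ultimately show ?thesis using incseq_le[of "\<lambda>k. W (int k + 1)" 0 0] by simp
qed

private lemma W_left: "W (-n) \<ge> 0" if "n > 0"
proof -
  have "decseq (\<lambda>k. W (- n - int k))"
  proof (rule decseq_SucI)
    fix k
    have "W (- n - int k) - W (- n - int k - 1) \<ge> 0"
      unfolding W_step using z that by (simp add: zero_le_mult_iff)
    moreover have "- n - int (Suc k) = - n - int k - 1" by simp
    ultimately show "W (- n - int (Suc k)) \<le> W (- n - int k)" by (simp only: diff_ge_0_iff_ge)
  qed
  moreover have "(\<lambda>k. W (- n - int k)) \<longlonglongrightarrow> 0" by (rule W_tendsto) (auto simp: inj_def)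
  ultimately show ?thesis using decseq_ge[of "\<lambda>k. W (- n - int k)" 0 0] by simp
qed

text \<open>Divided by |u(0)|^2, this says that q+ = - a(0) u(1) / u(0) has imaginary part at least
  Im z |u(1) / u(0)|^2, in particular a nonnegative one.\<close>

lemma green_right: "Im (of_real (a 0) * cnj (u 0) * u 1) \<le> - Im z * (cmod (u 1))\<^sup>2"
  using W_step[of 1] W_right by (simp add: W_def)

text \<open>The counterpart for q- = (1 - a(0) u(1)) / u(0): its imaginary part is at most - Im
  z.\<close>

lemma green_left: "- Im (u 0) - Im (of_real (a 0) * cnj (u 0) * u 1) \<le> - Im z * (cmod (u 0))\<^sup>2"
  using W_step[of 0] W_left[of 1] by (simp add: W_def)

text \<open>If u(0) = 0, then \<open>W\<close> vanishes at 0 and at -1, and the monotonicity forces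
  u(1) = u(-1) = 0, against the equation at 0. This works for vanishing a(0) or a(-1) as
  well.\<close>

lemma green_nonzero: "u 0 \<noteq> 0"
proof
  assume 0: "u 0 = 0"
  have "u 1 = 0" using green_right z 0 by (simp add: mult_le_0_iff)
  moreover have "Im z * (cmod (u (-1)))\<^sup>2 \<le> 0"
    using W_step[of "-1"] W_left[of 2] 0 by (simp add: W_def)
  then have "u (-1) = 0" using z by (simp add: mult_le_0_iff)
  ultimately show False using fun_cong[OF sol, of 0] 0 by (simp add: jacobi_shift_def jacobi_op_def delta_def)
qed

end

section \<open>Real square-summable sequences as an inner product space\<close>

lemma square_summable_mult:
  fixes f g :: "int \<Rightarrow> real"
  assumes "(\<lambda>n. (f n)\<^sup>2) summable_on UNIV" "(\<lambda>n. (g n)\<^sup>2) summable_on UNIV"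
  shows "(\<lambda>n. f n * g n) summable_on UNIV"
proof -
  have "(\<lambda>n. (f n)\<^sup>2 + (g n)\<^sup>2) summable_on UNIV" using assms by (rule summable_on_add)
  moreover have "norm (f n * g n) \<le> (f n)\<^sup>2 + (g n)\<^sup>2" for n
    using sum_squares_bound[of "\<bar>f n\<bar>" "\<bar>g n\<bar>"] mult_nonneg_nonneg[of "\<bar>f n\<bar>" "\<bar>g n\<bar>"]
    unfolding real_norm_def abs_mult power2_abs by linarith
  ultimately have "(\<lambda>n. norm (f n * g n)) summable_on UNIV"
    by (rule summable_on_comparison_test) auto
  then show ?thesis by (rule abs_summable_summable)
qed

text \<open>The spectral measure theorems speak about a type of class \<open>real_inner\<close>.
  Since the coefficients are real, a Jacobi matrix acts on real and imaginary parts separately, so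
  the real space suffices.\<close>

typedef real_ell2 = "{f :: int \<Rightarrow> real. (\<lambda>n. (f n)\<^sup>2) summable_on UNIV}"
  morphisms coord of_coord
  by (rule exI[of _ "\<lambda>_. 0"]) simp

lemma coord_sq_summable: "(\<lambda>n. (coord u n)\<^sup>2) summable_on UNIV"
  using coord[of u] by simp

lemma coord_mult_summable: "(\<lambda>n. coord u n * coord v n) summable_on UNIV"
  by (intro square_summable_mult coord_sq_summable)

lemma real_ell2_eqI: "(\<And>n. coord u n = coord v n) \<Longrightarrow> u = v"
  by (simp add: coord_inject[symmetric] fun_eq_iff)

instantiation real_ell2 :: real_vector
begin

definition "0 = of_coord (\<lambda>_. 0)"
definition "u + v = of_coord (\<lambda>n. coord u n + coord v n)"
definition "u - v = of_coord (\<lambda>n. coord u n - coord v n)"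
definition "- u = of_coord (\<lambda>n. - coord u n)"
definition "r *\<^sub>R u = of_coord (\<lambda>n. r * coord u n)"
lemma coord_simps [simp]:
  "coord 0 n = 0" "coord (u + v) n = coord u n + coord v n" "coord (u - v) n = coord u n - coord v n"
  "coord (- u) n = - coord u n" "coord (r *\<^sub>R u) n = r * coord u n"
proof -
  have add: "(\<lambda>n. (coord u n + coord v n)\<^sup>2) summable_on UNIV" for u v
    using summable_on_add[OF summable_on_add[OF coord_sq_summable[of u] coord_sq_summable[of v]]
        summable_on_cmult_right[OF coord_mult_summable[of u v], of 2]]
    by (simp add: power2_sum mult.assoc)
  have scale: "(\<lambda>n. (r * coord u n)\<^sup>2) summable_on UNIV" for r u
    unfolding power_mult_distrib by (intro summable_on_cmult_right coord_sq_summable)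
  have r: "coord (r *\<^sub>R u) n = r * coord u n" for r u n
    using scale by (simp add: scaleR_real_ell2_def of_coord_inverse)
  have "(\<lambda>n. (coord u n - coord v n)\<^sup>2) summable_on UNIV"
    using add[of u "(-1) *\<^sub>R v"] by (simp add: r)
  then show "coord (u - v) n = coord u n - coord v n" by (simp add: minus_real_ell2_def of_coord_inverse)
  show "coord (- u) n = - coord u n" using scale[of "-1" u] by (simp add: uminus_real_ell2_def of_coord_inverse)
  show "coord (r *\<^sub>R u) n = r * coord u n" by (rule r)
  show "coord (u + v) n = coord u n + coord v n" using add by (simp add: plus_real_ell2_def of_coord_inverse)
  show "coord 0 n = 0" by (simp add: zero_real_ell2_def of_coord_inverse)
qed

instance
proof
  fix u v w :: real_ell2 and r s :: real
  show "u + v + w = u + (v + w)" "u + v = v + u" "0 + u = u" "- u + u = 0" "u - v = u + - v"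
    "r *\<^sub>R (u + v) = r *\<^sub>R u + r *\<^sub>R v" "(r + s) *\<^sub>R u = r *\<^sub>R u + s *\<^sub>R u"
    "r *\<^sub>R s *\<^sub>R u = (r * s) *\<^sub>R u" "1 *\<^sub>R u = u"
    by (rule real_ell2_eqI; simp add: algebra_simps)+
qed

end

instantiation real_ell2 :: real_inner
begin

definition "inner u v = (\<Sum>\<^sub>\<infinity>n. coord u n * coord v n)"
definition "norm (u :: real_ell2) = sqrt (inner u u)"
definition "sgn (u :: real_ell2) = u /\<^sub>R norm u"
definition "dist u (v :: real_ell2) = norm (u - v)"
definition [code del]: "(uniformity :: (real_ell2 \<times> real_ell2) filter) = (INF e\<in>{0<..}. principal {(u, v). dist u v < e})"
definition [code del]: "open (U :: real_ell2 set) \<longleftrightarrow> (\<forall>u\<in>U. \<forall>\<^sub>F (u', v) in uniformity. u' = u \<longrightarrow> v \<in> U)"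

instance
proof
  fix u v w :: real_ell2 and r :: real
  show "sgn u = u /\<^sub>R norm u" "dist u v = norm (u - v)" "norm u = sqrt (inner u u)"
    by (simp_all add: sgn_real_ell2_def dist_real_ell2_def norm_real_ell2_def)
  show "uniformity = (INF e\<in>{0<..}. principal {(u, v :: real_ell2). dist u v < e})"
    by (rule uniformity_real_ell2_def)
  show "open U \<longleftrightarrow> (\<forall>u\<in>U. \<forall>\<^sub>F (u', v) in uniformity. u' = u \<longrightarrow> v \<in> U)" for U :: "real_ell2 set"
    by (rule open_real_ell2_def)
  show "inner u v = inner v u" by (simp add: inner_real_ell2_def mult.commute)
  show "inner (u + v) w = inner u w + inner v w"
    unfolding inner_real_ell2_def coord_simps distrib_right by (intro infsum_add coord_mult_summable)
  show "inner (r *\<^sub>R u) v = r * inner u v"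
    unfolding inner_real_ell2_def coord_simps mult.assoc by (intro infsum_cmult_right coord_mult_summable)
  show "0 \<le> inner u u" unfolding inner_real_ell2_def by (intro infsum_nonneg) simp
  show "inner u u = 0 \<longleftrightarrow> u = 0"
  proof
    assume "inner u u = 0"
    then have "coord u n * coord u n = 0" for n
      using nonneg_infsum_le_0D[of "\<lambda>n. coord u n * coord u n" UNIV n] coord_mult_summable[of u u]
      by (simp add: inner_real_ell2_def)
    then show "u = 0" by (intro real_ell2_eqI) simp
  qed (simp add: inner_real_ell2_def)
qed

end

section \<open>Existence of the associated measure\<close>

definition complexify :: "real_ell2 \<Rightarrow> int \<Rightarrow> complex" where
  "complexify u n = of_real (coord u n)"

lemma complexify_in_ell2: "complexify u \<in> ell2"
  using coord_sq_summable[of u] by (simp add: ell2_def complexify_def)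

lemma of_coord_Re_Im:
  assumes "w \<in> ell2"
  shows "coord (of_coord (\<lambda>n. Re (w n))) n = Re (w n)" "coord (of_coord (\<lambda>n. Im (w n))) n = Im (w n)"
proof -
  have "(\<lambda>n. (cmod (w n))\<^sup>2) summable_on UNIV" using assms by (simp add: ell2_def)
  then have "(\<lambda>n. (Re (w n))\<^sup>2) summable_on UNIV" "(\<lambda>n. (Im (w n))\<^sup>2) summable_on UNIV"
    by (rule summable_on_comparison_test; simp add: cmod_power2)+
  then show "coord (of_coord (\<lambda>n. Re (w n))) n = Re (w n)" "coord (of_coord (\<lambda>n. Im (w n))) n = Im (w n)"
    by (simp_all add: of_coord_inverse)
qed

lemma ell2_inner_complexify: "ell2_inner (complexify u) (complexify v) = of_real (inner u v)"
proof -
  have "ell2_inner (complexify u) (complexify v) = (\<Sum>\<^sub>\<infinity>n. of_real (coord u n * coord v n))"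
    by (simp add: ell2_inner_def complexify_def)
  also have "\<dots> = of_real (inner u v)"
    unfolding inner_real_ell2_def
    by (intro infsumI has_sum_bounded_linear[OF bounded_linear_of_real] has_sum_infsum coord_mult_summable)
  finally show ?thesis .
qed

lemma ell2_norm_complexify: "ell2_norm (complexify u) = norm u"
  by (simp add: ell2_norm_def norm_real_ell2_def inner_real_ell2_def complexify_def power2_eq_square)

text \<open>The sequence under \<open>Re\<close> is already real. Going through
  \<open>jacobi_op\<close> lets boundedness and symmetry be inherited from the complex
  operator.\<close>

definition jacobi_real_op :: "jacobi \<Rightarrow> real_ell2 \<Rightarrow> real_ell2" where
  "jacobi_real_op J u = of_coord (\<lambda>n. Re (jacobi_op J (complexify u) n))"

context
  fixes J :: jacobi
  assumes J: "J \<in> jacobi_matrices"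
begin

lemma jacobi_op_in_ell2: "u \<in> ell2 \<Longrightarrow> jacobi_op J u \<in> ell2"
  using jacobi_op_bounded[OF J] by auto

lemma coord_jacobi_real_op:
  "coord (jacobi_real_op J u) n =
    fst J n * coord u (n + 1) + fst J (n - 1) * coord u (n - 1) + snd J n * coord u n"
  unfolding jacobi_real_op_def of_coord_Re_Im(1)[OF jacobi_op_in_ell2[OF complexify_in_ell2]]
  by (simp add: jacobi_op_def complexify_def case_prod_beta)

lemma complexify_jacobi_real_op: "complexify (jacobi_real_op J u) = jacobi_op J (complexify u)"
  by (rule ext, subst complexify_def) (simp add: coord_jacobi_real_op, simp add: jacobi_op_def complexify_def case_prod_beta)

lemma jacobi_real_op_linear: "linear (jacobi_real_op J)"
  by (rule linearI; rule real_ell2_eqI; simp add: coord_jacobi_real_op algebra_simps)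

lemma jacobi_real_op_symmetric: "inner (jacobi_real_op J u) w = inner u (jacobi_real_op J w)"
proof -
  have "complex_of_real (inner u (jacobi_real_op J w)) = of_real (inner (jacobi_real_op J u) w)"
    unfolding ell2_inner_complexify[symmetric] complexify_jacobi_real_op
    by (intro jacobi_op_symmetric J complexify_in_ell2)
  then show ?thesis by (simp only: of_real_eq_iff)
qed

lemma jacobi_real_op_form_bounded: "\<exists>R>0. \<forall>u. \<bar>inner u (jacobi_real_op J u)\<bar> \<le> R * inner u u"
proof -
  obtain C where C: "\<And>u. u \<in> ell2 \<Longrightarrow> ell2_norm (jacobi_op J u) \<le> C * ell2_norm u"
    using jacobi_op_bounded[OF J] by auto
  have "\<bar>inner u (jacobi_real_op J u)\<bar> \<le> max C 1 * inner u u" for u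
  proof -
    have "\<bar>inner u (jacobi_real_op J u)\<bar> \<le> norm u * norm (jacobi_real_op J u)" by (rule Cauchy_Schwarz_ineq2)
    also have "norm (jacobi_real_op J u) \<le> C * norm u"
      using C[OF complexify_in_ell2, of u] by (simp add: ell2_norm_complexify flip: complexify_jacobi_real_op)
    then have "norm u * norm (jacobi_real_op J u) \<le> norm u * (max C 1 * norm u)"
      using mult_right_mono[of C "max C 1" "norm u"] by (intro mult_left_mono) auto
    finally show ?thesis by (simp only: power2_norm_eq_inner[symmetric] power2_eq_square mult_ac)
  qed
  then show ?thesis by (intro exI[of _ "max C 1"]) auto
qed

end

lemma cauchy_kernel_integral:
  fixes \<mu> :: "real measure"
  assumes "sets \<mu> = sets borel" "finite_measure \<mu>" "y > 0"
  shows "(\<integral>t. 1 / (of_real t - Complex x y) \<partial>\<mu>)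
      = Complex (\<integral>t. (t - x) / ((t - x)\<^sup>2 + y\<^sup>2) \<partial>\<mu>) (y * (\<integral>t. 1 / ((t - x)\<^sup>2 + y\<^sup>2) \<partial>\<mu>))"
    and "integrable \<mu> (\<lambda>t. 1 / ((t - x)\<^sup>2 + y\<^sup>2))"
proof -
  interpret finite_measure \<mu> by fact
  have pos: "(t - x)\<^sup>2 + y\<^sup>2 > 0" for t using assms(3) by (simp add: add_nonneg_pos)
  have eq: "1 / (of_real t - Complex x y) = Complex ((t - x) / ((t - x)\<^sup>2 + y\<^sup>2)) (y / ((t - x)\<^sup>2 + y\<^sup>2))" for t
    by (simp add: complex_eq_iff Re_divide Im_divide power2_eq_square)
  have bm: "f \<in> borel_measurable \<mu> \<longleftrightarrow> f \<in> borel_measurable borel" for f :: "real \<Rightarrow> 'b::topological_space"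
    by (simp add: measurable_cong_sets[OF assms(1) refl])
  have int: "integrable \<mu> (\<lambda>t. 1 / (of_real t - Complex x y))"
  proof (rule integrable_const_bound[where B = "1 / y"])
    show "AE t in \<mu>. norm (1 / (complex_of_real t - Complex x y)) \<le> 1 / y"
    proof (intro AE_I2)
      fix t
      have "y \<le> cmod (of_real t - Complex x y)"
        using abs_Im_le_cmod[of "of_real t - Complex x y"] assms(3) by simp
      then show "norm (1 / (complex_of_real t - Complex x y)) \<le> 1 / y"
        using assms(3) by (simp add: norm_divide frac_le)
    qed
    show "(\<lambda>t. 1 / (complex_of_real t - Complex x y)) \<in> borel_measurable \<mu>"
      unfolding bm by measurable
  qed
  show "(\<integral>t. 1 / (of_real t - Complex x y) \<partial>\<mu>)
      = Complex (\<integral>t. (t - x) / ((t - x)\<^sup>2 + y\<^sup>2) \<partial>\<mu>) (y * (\<integral>t. 1 / ((t - x)\<^sup>2 + y\<^sup>2) \<partial>\<mu>))"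
    using integral_Re[OF int] integral_Im[OF int]
    by (simp add: complex_eq_iff eq flip: integral_mult_right_zero)
  show "integrable \<mu> (\<lambda>t. 1 / ((t - x)\<^sup>2 + y\<^sup>2))"
  proof (rule integrable_const_bound[where B = "1 / y\<^sup>2"])
    show "AE t in \<mu>. norm (1 / ((t - x)\<^sup>2 + y\<^sup>2)) \<le> 1 / y\<^sup>2"
      using assms(3) pos by (intro AE_I2) (auto intro!: frac_le simp: less_imp_le)
    show "(\<lambda>t. 1 / ((t - x)\<^sup>2 + y\<^sup>2)) \<in> borel_measurable \<mu>"
      unfolding bm by measurable
  qed
qed

lemma g0_eq:
  assumes "jacobi_resolvent J z (delta 0) = u"
  shows "g0 J z = u 0"
  using assms by (simp add: g0_def ell2_inner_delta)

text \<open>A Schur complement. Cutting the bonds a(0) and a(-1) turns J into \<open>D\<close>, and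
  v = a(0) \<delta>_1 + a(-1) \<delta>_{-1} carries the removed coupling to the site 0; then - 1 /
  g0 = z - b(0) + <v, (D - z)^-1 v>. So the spectral measure of \<open>D\<close> at \<open>v\<close>
  serves, with A = - b(0).\<close>

theorem associated_measure_exists:
  assumes J: "J \<in> jacobi_matrices" and res: "\<And>z. Im z > 0 \<Longrightarrow> z \<in> jacobi_resolvent_set J"
  shows "\<exists>\<rho>. associated_measure J \<rho>"
proof -
  obtain a b where ab: "J = (a, b)" by (cases J)
  define a' where "a' = a(0 := 0, -1 := 0)"
  define D where "D = (a', b)"
  have D: "D \<in> jacobi_matrices"
  proof -
    have "range a' \<subseteq> insert 0 (range a)" by (auto simp: a'_def)
    then show ?thesis
      using J bounded_subset[of "insert 0 (range a)" "range a'"] by (auto simp: ab D_def jacobi_matrices_def a'_def)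
  qed
  define T where "T = jacobi_real_op D"
  have coordT: "coord (T u) n = a' n * coord u (n + 1) + a' (n - 1) * coord u (n - 1) + b n * coord u n" for u n
    using coord_jacobi_real_op[OF D, of u n] by (simp add: T_def D_def)
  have lin: "linear T" and sym: "inner (T u) w = inner u (T w)" for u w
    unfolding T_def using jacobi_real_op_linear[OF D] jacobi_real_op_symmetric[OF D] by auto
  define v where "v = of_coord (\<lambda>n. if n = 1 then a 0 else if n = -1 then a (-1) else 0)"
  have v: "coord v n = (if n = 1 then a 0 else if n = -1 then a (-1) else 0)" for n
  proof -
    define f where "f n = (if n = 1 then a 0 else if n = -1 then a (-1) else 0)" for n :: int
    have "(\<lambda>n. (f n)\<^sup>2) summable_on {1, -1}" by simp
    also have "?this \<longleftrightarrow> (\<lambda>n. (f n)\<^sup>2) summable_on UNIV"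
      by (rule summable_on_cong_neutral) (auto simp: f_def)
    finally have "coord (of_coord f) n = f n" by (simp add: of_coord_inverse)
    then show ?thesis by (simp add: v_def f_def[abs_def])
  qed
  have inner_v: "inner v u = a 0 * coord u 1 + a (-1) * coord u (-1)" for u
  proof -
    have "(\<Sum>\<^sub>\<infinity>n. coord v n * coord u n) = (\<Sum>\<^sub>\<infinity>n\<in>{1, -1}. coord v n * coord u n)"
      by (rule infsum_cong_neutral) (auto simp: v)
    then show ?thesis by (simp add: inner_real_ell2_def v)
  qed
  obtain R where R: "R > 0" "\<And>u. \<bar>inner u (T u)\<bar> \<le> R * inner u u"
    using jacobi_real_op_form_bounded[OF D] by (auto simp: T_def)
  obtain \<mu> :: "real measure" where \<mu>: "sets \<mu> = sets borel" "finite_measure \<mu>" "emeasure \<mu> (- {-R..R}) = 0"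
    and mom: "\<And>p. inner v (poly_op T p v) = (\<integral>x. poly p x \<partial>\<mu>)"
    using spectral_measure_exists[OF lin sym R] by blast
  have "H_function J z = z + of_real (- b 0) + (\<integral>t. 1 / (of_real t - z) \<partial>\<mu>)" if z: "Im z > 0" for z
  proof -
    define x y where "x = Re z" and "y = Im z"
    have zxy: "z = Complex x y" by (simp add: x_def y_def)
    have y: "y > 0" using z by (simp add: y_def)
    define u where "u = jacobi_resolvent J z (delta 0)"
    have u: "u \<in> ell2" "jacobi_shift J z u = delta 0"
      using jacobi_resolvent_shift[OF res[OF z]] delta_in_ell2 by (auto simp: u_def)
    have u0: "u 0 \<noteq> 0" using green_nonzero[of a b z u] J z u by (simp add: ab)
    have eq: "of_real (a n) * u (n + 1) + of_real (a (n - 1)) * u (n - 1) + of_real (b n) * u n - z * u n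
      = (if n = 0 then 1 else 0)" for n
      using fun_cong[OF u(2), of n] by (simp add: ab jacobi_shift_def jacobi_op_def delta_def)
    \<comment> \<open>The solution of (D - z) w = v is read off \<open>u\<close>, so the resolvent
      of \<open>D\<close> need not be constructed.\<close>
    define w where "w n = (if n = 0 then 0 else - u n / u 0)" for n
    have w: "w \<in> ell2"
      by (rule ell2_bound[OF ell2_cmult[OF u(1), of "1 / u 0"]]) (auto simp: w_def norm_divide)
    have eqw: "of_real (a' n) * w (n + 1) + of_real (a' (n - 1)) * w (n - 1) + of_real (b n) * w n - z * w n
      = of_real (coord v n)" for n
    proof -
      consider "n = 0" | "n = 1" | "n = -1" | "n \<notin> {0, 1, -1}" by auto
      then show ?thesis
      proof cases
        case 2
        then show ?thesis using eq[of 1] u0 by (simp add: a'_def w_def v field_simps)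
      next
        case 3
        then show ?thesis using eq[of "-1"] u0 by (simp add: a'_def w_def v field_simps)
      next
        case 4
        then have n: "n + 1 \<noteq> 0" "n - 1 \<noteq> 0" "n \<noteq> 0" "n - 1 \<noteq> -1" "n \<noteq> -1" "n \<noteq> 1" by auto
        have "p * (- p' / c) + q * (- q' / c) + r * (- r' / c) - z * (- r' / c) = - (p * p' + q * q' + r * r' - z * r') / c"
          for p p' q q' r r' c :: complex
          by (cases "c = 0") (simp_all add: field_simps)
        then show ?thesis using eq[of n] n by (simp add: a'_def w_def v)
      next
        case 1
        show ?thesis unfolding 1 by (simp add: a'_def w_def v)
      qed
    qed
    define w1 w2 where "w1 = of_coord (\<lambda>n. Re (w n))" and "w2 = of_coord (\<lambda>n. Im (w n))"
    have w1: "coord w1 n = Re (w n)" and w2: "coord w2 n = Im (w n)" for n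
      by (simp_all add: w1_def w2_def of_coord_Re_Im[OF w])
    have e1: "T w1 - x *\<^sub>R w1 + y *\<^sub>R w2 = v"
    proof (rule real_ell2_eqI)
      fix n show "coord (T w1 - x *\<^sub>R w1 + y *\<^sub>R w2) n = coord v n"
        using arg_cong[OF eqw[of n], of Re] by (simp add: coordT w1 w2 x_def y_def)
    qed
    have e2: "T w2 - x *\<^sub>R w2 - y *\<^sub>R w1 = 0"
    proof (rule real_ell2_eqI)
      fix n show "coord (T w2 - x *\<^sub>R w2 - y *\<^sub>R w1) n = coord 0 n"
        using arg_cong[OF eqw[of n], of Im] by (simp add: coordT w1 w2 x_def y_def)
    qed
    \<comment> \<open>The real and imaginary parts satisfy (T - x) w1 + y w2 = v and (T - x) w2 = y
      w1. Eliminating w1 gives ((T - x)^2 + y^2) g = v for g = w2 / y.\<close>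
    define g where "g = (1 / y) *\<^sub>R w2"
    have w2g: "w2 = y *\<^sub>R g" using y by (simp add: g_def)
    have w1g: "w1 = T g - x *\<^sub>R g"
    proof -
      have "y *\<^sub>R w1 = y *\<^sub>R (T g - x *\<^sub>R g)"
        using e2 by (simp add: w2g linear_scale[OF lin] algebra_simps)
      then show ?thesis using y by simp
    qed
    have g: "poly_op T [:x\<^sup>2 + y\<^sup>2, - 2 * x, 1:] g = v"
      unfolding e1[symmetric] w1g w2g
      by (simp add: lin linear_0[OF lin] linear_diff[OF lin] linear_add[OF lin] linear_scale[OF lin] linear_neg[OF lin] power2_eq_square algebra_simps)
        (simp flip: scaleR_add_left)
    have "y \<noteq> 0" using y by simp
    have rep: "inner v (poly_op T q g) = (\<integral>t. poly q t / ((t - x)\<^sup>2 + y\<^sup>2) \<partial>\<mu>)" for q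
      by (rule spectral_measure_resolvent[where R = R and T = T and v = v]; fact)
    have i2: "inner v g = (\<integral>t. 1 / ((t - x)\<^sup>2 + y\<^sup>2) \<partial>\<mu>)"
      using rep[of 1] by (simp add: one_pCons lin linear_0[OF lin])
    have i1: "inner v w1 = (\<integral>t. (t - x) / ((t - x)\<^sup>2 + y\<^sup>2) \<partial>\<mu>)"
    proof -
      have "poly_op T [:-x, 1:] g = w1" by (simp add: w1g lin linear_0[OF lin])
      then show ?thesis using rep[of "[:-x, 1:]"] by simp
    qed
    have "H_function J z = - 1 / u 0" by (simp add: H_function_def g0_eq[OF u_def[symmetric]])
    also have "\<dots> = z + of_real (- b 0) + (of_real (a 0) * w 1 + of_real (a (-1)) * w (-1))"
      using eq[of 0] u0 by (simp add: w_def field_simps)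
    also have "of_real (a 0) * w 1 + of_real (a (-1)) * w (-1) = Complex (inner v w1) (inner v w2)"
      by (simp add: complex_eq_iff inner_v w1 w2)
    also have "inner v w2 = y * inner v g" by (simp add: w2g)
    also have "Complex (inner v w1) (y * inner v g) = (\<integral>t. 1 / (of_real t - z) \<partial>\<mu>)"
      unfolding zxy cauchy_kernel_integral(1)[OF \<mu>(1,2) y] i1 i2 ..
    finally show ?thesis .
  qed
  then have "\<exists>A::real. \<forall>z. Im z > 0 \<longrightarrow> H_function J z = z + of_real A + (\<integral>t. 1 / (of_real t - z) \<partial>\<mu>)"
    by blast
  moreover have "\<exists>C. compact C \<and> emeasure \<mu> (- C) = 0"
    using \<mu>(3) compact_Icc by blast
  ultimately show ?thesis
    unfolding associated_measure_def using \<mu>(1,2) by blast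
qed

text \<open>On the ball of radius y around x the kernel 1 / ((t - x)^2 + y^2) is at least 1 / (2
  y^2), and its integral against \<open>\<rho>\<close> is read off the imaginary part of H at height
  y.\<close>

lemma associated_measure_ball_le:
  assumes \<rho>: "associated_measure J \<rho>" and y: "y > 0"
  shows "measure \<rho> (ball x y) \<le> 2 * y * Im (H_function J (Complex x y))"
proof -
  obtain A :: real where s: "sets \<rho> = sets borel" and f: "finite_measure \<rho>"
    and H: "\<And>z. Im z > 0 \<Longrightarrow> H_function J z = z + of_real A + (\<integral>t. 1 / (of_real t - z) \<partial>\<rho>)"
    using \<rho> by (auto simp: associated_measure_def)
  interpret finite_measure \<rho> by fact
  have "Im (H_function J (Complex x y)) = y + y * (\<integral>t. 1 / ((t - x)\<^sup>2 + y\<^sup>2) \<partial>\<rho>)"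
    using y by (simp add: H cauchy_kernel_integral(1)[OF s f])
  moreover have "measure \<rho> (ball x y) / (2 * y\<^sup>2) \<le> (\<integral>t. 1 / ((t - x)\<^sup>2 + y\<^sup>2) \<partial>\<rho>)"
  proof -
    have "(\<integral>t. indicator (ball x y) t * (1 / (2 * y\<^sup>2)) \<partial>\<rho>) \<le> (\<integral>t. 1 / ((t - x)\<^sup>2 + y\<^sup>2) \<partial>\<rho>)"
    proof (rule integral_mono)
      show "integrable \<rho> (\<lambda>t. 1 / ((t - x)\<^sup>2 + y\<^sup>2))" by (rule cauchy_kernel_integral(2)[OF s f y])
      show "integrable \<rho> (\<lambda>t. indicator (ball x y) t * (1 / (2 * y\<^sup>2)))"
        by (intro integrable_mult_left integrable_real_indicator) (simp_all add: s less_top[symmetric])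
      fix t
      have "(t - x)\<^sup>2 \<le> y\<^sup>2" if "t \<in> ball x y"
        using that y by (intro abs_le_square_iff[THEN iffD1]) (auto simp: dist_real_def)
      moreover have "0 < (t - x)\<^sup>2 + y\<^sup>2" using y by (intro add_nonneg_pos) auto
      ultimately show "indicator (ball x y) t * (1 / (2 * y\<^sup>2)) \<le> 1 / ((t - x)\<^sup>2 + y\<^sup>2)"
        using frac_le[of 1 1 "(t - x)\<^sup>2 + y\<^sup>2" "2 * y\<^sup>2"] by (cases "t \<in> ball x y") auto
    qed
    then show ?thesis by (simp add: s)
  qed
  ultimately have "measure \<rho> (ball x y) \<le> 2 * y * (Im (H_function J (Complex x y)) - y)"
    using y by (simp add: divide_le_eq power2_eq_square mult_ac)
  also have "\<dots> \<le> 2 * y * Im (H_function J (Complex x y))"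
    using y by (intro mult_left_mono) auto
  finally show ?thesis .
qed

section \<open>The Darboux transformation\<close>

lemma two_band_bounded:
  fixes p q :: "int \<Rightarrow> real" and k :: int
  assumes u: "u \<in> ell2" and p: "\<And>n. \<bar>p n\<bar> \<le> B" and q: "\<And>n. \<bar>q n\<bar> \<le> B"
  shows "(\<lambda>n. of_real (p n) * u n + of_real (q n) * u (n + k)) \<in> ell2" (is "?v \<in> ell2")
    and "ell2_norm (\<lambda>n. of_real (p n) * u n + of_real (q n) * u (n + k)) \<le> 2 * B * ell2_norm u"
proof -
  have B: "0 \<le> B" using p[of 0] by linarith
  define f where "f n = (cmod (u n))\<^sup>2" for n
  have f: "f summable_on UNIV" using u by (simp add: ell2_def f_def[abs_def])
  have f1: "(\<lambda>n. f (n + k)) summable_on UNIV" using f summable_on_int_shift[of f k] by simp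
  have g: "(\<lambda>n. 2 * B\<^sup>2 * (f n + f (n + k))) summable_on UNIV"
    by (intro summable_on_cmult_right summable_on_add f f1)
  have le: "(cmod (?v n))\<^sup>2 \<le> 2 * B\<^sup>2 * (f n + f (n + k))" for n
  proof -
    have "cmod (?v n) \<le> B * cmod (u n) + B * cmod (u (n + k))"
      using p[of n] q[of n]
      by (intro order.trans[OF norm_triangle_ineq] add_mono) (auto simp: norm_mult intro!: mult_right_mono)
    then have "(cmod (?v n))\<^sup>2 \<le> (B * (cmod (u n) + cmod (u (n + k))))\<^sup>2"
      by (intro power_mono) (auto simp: algebra_simps)
    also have "\<dots> \<le> B\<^sup>2 * (2 * (f n + f (n + k)))"
      unfolding power_mult_distrib f_def
      using sum_squares_bound[of "cmod (u n)" "cmod (u (n + k))"] by (intro mult_left_mono) (auto simp: power2_sum)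
    finally show ?thesis by (simp only: mult_ac)
  qed
  have s: "(\<lambda>n. (cmod (?v n))\<^sup>2) summable_on UNIV"
    by (rule summable_on_comparison_test[OF g]) (auto intro: le)
  then show "?v \<in> ell2" by (simp add: ell2_def)
  have "(\<Sum>\<^sub>\<infinity>n. (cmod (?v n))\<^sup>2) \<le> (\<Sum>\<^sub>\<infinity>n. 2 * B\<^sup>2 * (f n + f (n + k)))"
    by (intro infsum_mono s g le)
  also have "\<dots> = 2 * B\<^sup>2 * (infsum f UNIV + infsum f UNIV)"
    by (subst infsum_cmult_right) (auto intro!: summable_on_add f f1 simp: infsum_add[OF f f1] infsum_int_shift)
  also have "\<dots> = (2 * B)\<^sup>2 * infsum f UNIV" by (simp add: power2_eq_square)
  finally have "ell2_norm ?v \<le> sqrt ((2 * B)\<^sup>2 * infsum f UNIV)"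
    unfolding ell2_norm_def by (rule real_sqrt_le_mono)
  also have "\<dots> = 2 * B * ell2_norm u"
    using B by (simp add: real_sqrt_mult ell2_norm_def f_def[abs_def])
  finally show "ell2_norm ?v \<le> 2 * B * ell2_norm u" .
qed

lemma ell2_norm_nonneg: "0 \<le> ell2_norm u"
  unfolding ell2_norm_def by (simp add: infsum_nonneg)

text \<open>The factorization \<open>J - \<kappa> = L L\<^sup>*\<close> with \<open>L\<close> lower bidiagonal and its commuted version
  \<open>J' = L\<^sup>* L + \<kappa>\<close>; the diagonal of \<open>L\<close> is the square root of \<open>s\<close>.\<close>

locale darboux =
  fixes a b s :: "int \<Rightarrow> real" and \<kappa> c M :: real
  assumes a_nonneg: "0 \<le> a n" and a_le: "a n \<le> M" and c_pos: "0 < c" and M_le: "M \<le> c"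
    and s_ge: "c \<le> s n" and s_le: "s n \<le> 4 * c" and b_le: "\<bar>b n\<bar> \<le> M"
    and rec: "s n + (a (n - 1))\<^sup>2 / s (n - 1) = b n - \<kappa>"
begin

definition x :: "int \<Rightarrow> real" where "x n = sqrt (s n)"
definition y :: "int \<Rightarrow> real" where "y n = a n / sqrt (s n)"

definition L :: "(int \<Rightarrow> complex) \<Rightarrow> int \<Rightarrow> complex" where
  "L u n = of_real (x n) * u n + of_real (y (n - 1)) * u (n - 1)"

definition L' :: "(int \<Rightarrow> complex) \<Rightarrow> int \<Rightarrow> complex" where
  "L' u n = of_real (x n) * u n + of_real (y n) * u (n + 1)"

definition J :: jacobi where "J = (a, b)"

definition J' :: jacobi where "J' = (\<lambda>n. y n * x (n + 1), \<lambda>n. (x n)\<^sup>2 + (y n)\<^sup>2 + \<kappa>)"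

lemma s_pos: "0 < s n" using s_ge[of n] c_pos by linarith
lemma x_pos: "0 < x n" by (simp add: x_def s_pos)
lemma x_sq: "(x n)\<^sup>2 = s n" using s_pos[of n] by (simp add: x_def)
lemma xy: "x n * y n = a n" using s_pos[of n] by (simp add: x_def y_def)
lemma y_nonneg: "0 \<le> y n" by (simp add: y_def a_nonneg s_pos less_imp_le)
lemma y_sq: "(y n)\<^sup>2 = (a n)\<^sup>2 / s n" using s_pos[of n] by (simp add: y_def power_divide)
lemma diag: "(x n)\<^sup>2 + (y (n - 1))\<^sup>2 = b n - \<kappa>" by (simp add: x_sq y_sq rec)

lemma x_ge: "sqrt c \<le> x n" by (simp add: x_def s_ge)
text \<open>Holds since x(n) y(n) = a(n) \<le> c. With \<open>x_ge\<close>, every value of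
  \<open>y\<close> is at most every value of \<open>x\<close>, which is what makes \<open>L\<close>
  injective.\<close>

lemma y_le: "y n \<le> sqrt c"
proof -
  have "y n * sqrt c \<le> y n * x n" by (intro mult_left_mono x_ge y_nonneg)
  also have "\<dots> \<le> c" using a_le[of n] M_le by (simp add: xy mult.commute)
  also have "\<dots> = sqrt c * sqrt c" using c_pos by simp
  finally show ?thesis using c_pos by (simp only: mult_le_cancel_right) auto
qed
lemma x_le: "x n \<le> 2 * sqrt c"
proof -
  have "sqrt (s n) \<le> sqrt (4 * c)" using s_le by simp
  then show ?thesis by (simp add: x_def real_sqrt_mult)
qed

lemma J_in: "J \<in> jacobi_matrices"
proof -
  have "\<forall>z\<in>range a. norm z \<le> M" "\<forall>z\<in>range b. norm z \<le> M" using a_nonneg a_le b_le by auto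
  then show ?thesis by (auto simp: J_def jacobi_matrices_def a_nonneg bounded_iff)
qed

lemma J'_in: "J' \<in> jacobi_matrices"
proof -
  have "norm (y n * x (n + 1)) \<le> 2 * c" for n
  proof -
    have "y n * x (n + 1) \<le> sqrt c * (2 * sqrt c)"
      using c_pos by (intro mult_mono y_le x_le less_imp_le[OF x_pos]) auto
    also have "\<dots> = 2 * c" using c_pos by simp
    finally show ?thesis using y_nonneg[of n] x_pos[of "n + 1"] by (simp add: abs_mult)
  qed
  moreover have "norm ((x n)\<^sup>2 + (y n)\<^sup>2 + \<kappa>) \<le> 5 * c + \<bar>\<kappa>\<bar>" for n
  proof -
    have "(y n)\<^sup>2 \<le> (sqrt c)\<^sup>2" by (intro power_mono y_le y_nonneg)
    then have "(y n)\<^sup>2 \<le> c" using c_pos by simp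
    moreover have "0 \<le> (y n)\<^sup>2" by simp
    ultimately show ?thesis using s_le[of n] s_pos[of n] unfolding x_sq real_norm_def by arith
  qed
  ultimately have "\<forall>z\<in>range (\<lambda>n. y n * x (n + 1)). norm z \<le> 2 * c"
    "\<forall>z\<in>range (\<lambda>n. (x n)\<^sup>2 + (y n)\<^sup>2 + \<kappa>). norm z \<le> 5 * c + \<bar>\<kappa>\<bar>" by auto
  then show ?thesis
    unfolding J'_def jacobi_matrices_def
    by (auto simp: bounded_iff intro!: mult_nonneg_nonneg y_nonneg less_imp_le[OF x_pos])
qed

lemma L_L': "L (L' u) = jacobi_shift J (of_real \<kappa>) u"
proof
  fix n
  have d: "complex_of_real (b n) - of_real \<kappa> = (of_real (x n))\<^sup>2 + (of_real (y (n - 1)))\<^sup>2"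
    using arg_cong[OF diag[of n], of complex_of_real] by simp
  have "jacobi_shift J (of_real \<kappa>) u n = of_real (x n * y n) * u (n + 1)
    + of_real (x (n - 1) * y (n - 1)) * u (n - 1) + (of_real (b n) - of_real \<kappa>) * u n"
    by (simp only: xy) (simp add: jacobi_shift_def jacobi_op_def J_def algebra_simps)
  then show "L (L' u) n = jacobi_shift J (of_real \<kappa>) u n"
    unfolding d by (simp add: L_def L'_def power2_eq_square algebra_simps)
qed

lemma L'_L: "L' (L u) = jacobi_shift J' (of_real \<kappa>) u"
  by (simp add: fun_eq_iff jacobi_shift_def jacobi_op_def J'_def L_def L'_def power2_eq_square algebra_simps)

lemma shift_J: "jacobi_shift J z u n = L (L' u) n + (of_real \<kappa> - z) * u n"
  unfolding L_L' by (simp add: jacobi_shift_def algebra_simps)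

lemma shift_J': "jacobi_shift J' z u n = L' (L u) n + (of_real \<kappa> - z) * u n"
  unfolding L'_L by (simp add: jacobi_shift_def algebra_simps)

text \<open>Intertwining, from L (L' L) = (L L') L; it holds for arbitrary sequences,
  square-summable or not.\<close>

lemma L_shift: "L (jacobi_shift J' z u) = jacobi_shift J z (L u)"
proof -
  have "jacobi_shift J' z u = (\<lambda>n. L' (L u) n + (of_real \<kappa> - z) * u n)" by (simp add: shift_J' fun_eq_iff)
  then have "L (jacobi_shift J' z u) = L (\<lambda>n. L' (L u) n + (of_real \<kappa> - z) * u n)" by (rule arg_cong)
  also have "\<dots> = jacobi_shift J z (L u)" by (rule ext) (simp add: shift_J, simp add: L_def algebra_simps)
  finally show ?thesis .
qed

lemma L'_shift: "L' (jacobi_shift J z u) = jacobi_shift J' z (L' u)"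
proof -
  have "jacobi_shift J z u = (\<lambda>n. L (L' u) n + (of_real \<kappa> - z) * u n)" by (simp add: shift_J fun_eq_iff)
  then have "L' (jacobi_shift J z u) = L' (\<lambda>n. L (L' u) n + (of_real \<kappa> - z) * u n)" by (rule arg_cong)
  also have "\<dots> = jacobi_shift J' z (L' u)" by (rule ext) (simp add: shift_J', simp add: L'_def algebra_simps)
  finally show ?thesis .
qed

lemma L_ell2: "u \<in> ell2 \<Longrightarrow> L u \<in> ell2" "u \<in> ell2 \<Longrightarrow> ell2_norm (L u) \<le> 4 * sqrt c * ell2_norm u"
  and L'_ell2: "u \<in> ell2 \<Longrightarrow> L' u \<in> ell2" "u \<in> ell2 \<Longrightarrow> ell2_norm (L' u) \<le> 4 * sqrt c * ell2_norm u"
proof -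
  assume u: "u \<in> ell2"
  have p: "\<bar>x n\<bar> \<le> 2 * sqrt c" "\<bar>y n\<bar> \<le> 2 * sqrt c" for n
    using x_pos[of n] x_le[of n] y_nonneg[of n] y_le[of n] c_pos
    by (auto simp: abs_of_pos intro: order.trans)
  show "L u \<in> ell2" "ell2_norm (L u) \<le> 4 * sqrt c * ell2_norm u"
    using two_band_bounded[OF u, of x "2 * sqrt c" "\<lambda>n. y (n - 1)" "- 1", OF p(1) p(2)]
    by (simp_all add: L_def[abs_def])
  show "L' u \<in> ell2" "ell2_norm (L' u) \<le> 4 * sqrt c * ell2_norm u"
    using two_band_bounded[OF u, of x "2 * sqrt c" y 1, OF p]
    by (simp_all add: L'_def[abs_def])
qed

lemma L_diff: "L (\<lambda>n. u n - v n) n = L u n - L v n"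
  by (simp add: L_def algebra_simps)

text \<open>As y \<le> x, the equation L u = 0 makes |u(n)| nonincreasing in n, while u tends to 0
  at minus infinity.\<close>

lemma L_kernel:
  assumes u: "u \<in> ell2" and "\<And>n. L u n = 0"
  shows "u n = 0"
proof -
  have step: "cmod (u n) \<le> cmod (u (n - 1))" for n
  proof -
    have "of_real (x n) * u n = - (of_real (y (n - 1)) * u (n - 1))"
      using assms(2)[of n] by (simp add: L_def add_eq_0_iff)
    then have "cmod (of_real (x n) * u n) = cmod (of_real (y (n - 1)) * u (n - 1))" by simp
    then have "x n * cmod (u n) = y (n - 1) * cmod (u (n - 1))"
      using x_pos[of n] y_nonneg[of "n - 1"] by (simp add: norm_mult)
    also have "\<dots> \<le> x n * cmod (u (n - 1))"
      using y_le[of "n - 1"] x_ge[of n] by (intro mult_right_mono) auto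
    finally show ?thesis using x_pos[of n] by simp
  qed
  have "cmod (u n) \<le> cmod (u (n - int k))" for k
  proof (induction k)
    case (Suc k)
    have "cmod (u (n - int k)) \<le> cmod (u (n - int (Suc k)))" using step[of "n - int k"] by (simp add: algebra_simps)
    with Suc show ?case by linarith
  qed simp
  moreover have "(\<lambda>k. cmod (u (n - int k))) \<longlonglongrightarrow> 0"
    by (intro tendsto_norm_zero ell2_tendsto_0 u) (auto simp: inj_def)
  ultimately have "cmod (u n) \<le> 0" by (intro LIMSEQ_le_const) auto
  then show ?thesis by simp
qed

lemma L_inject:
  assumes "u \<in> ell2" "v \<in> ell2" "L u = L v"
  shows "u = v"
proof
  fix n
  show "u n = v n" using L_kernel[OF ell2_minus[OF assms(1,2)], of n] assms(3) by (simp add: L_diff)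
qed

text \<open>Both inverse identities are checked after applying \<open>L\<close>, which is injective
  on \<open>ell2\<close>: there L L' cancels the inverse of J - \<kappa>, and \<open>L\<close>
  intertwines the two matrices. This is where \<kappa> has to avoid the spectrum of J.\<close>

lemma resolvent_set_transfer:
  assumes z: "z \<in> jacobi_resolvent_set J" and k: "of_real \<kappa> \<in> jacobi_resolvent_set J"
  shows "z \<in> jacobi_resolvent_set J'"
proof -
  define R where "R = jacobi_resolvent J z"
  define Q where "Q = jacobi_resolvent J (of_real \<kappa>)"
  define S where "S f = L' (Q (R (L f)))" for f
  note Rz = jacobi_resolvent_shift[OF z, folded R_def] and Qk = jacobi_resolvent_shift[OF k, folded Q_def]
  have S_in: "S f \<in> ell2" if "f \<in> ell2" for f
    unfolding S_def using that by (intro L'_ell2 Qk(1) Rz(1) L_ell2)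
  have LS: "L (S f) = R (L f)" if "f \<in> ell2" for f
    unfolding S_def L_L' using that by (intro Qk(2) Rz(1) L_ell2)
  have right: "jacobi_shift J' z (S f) = f" if f: "f \<in> ell2" for f
  proof (rule L_inject)
    show "L (jacobi_shift J' z (S f)) = L f"
      unfolding L_shift LS[OF f] using f by (intro Rz(2) L_ell2)
  qed (intro jacobi_shift_in_ell2 J'_in S_in f)+
  have left: "S (jacobi_shift J' z u) = u" if u: "u \<in> ell2" for u
  proof (rule L_inject)
    have "L (S (jacobi_shift J' z u)) = R (jacobi_shift J z (L u))"
      using u by (simp add: LS[OF jacobi_shift_in_ell2[OF J'_in u]] L_shift)
    then show "L (S (jacobi_shift J' z u)) = L u" using u by (simp add: Rz(3) L_ell2)
  qed (intro jacobi_shift_in_ell2 J'_in S_in u)+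
  have bij: "bij_betw (jacobi_shift J' z) ell2 ell2"
    by (rule bij_betw_byWitness[where f' = S]) (auto simp: left right S_in jacobi_shift_in_ell2[OF J'_in])
  have res: "jacobi_resolvent J' z f = S f" if "f \<in> ell2" for f
    unfolding jacobi_resolvent_def using bij that
    by (intro inv_into_f_eq) (auto simp: bij_betw_def right S_in)
  obtain C1 where C1: "\<And>v. v \<in> ell2 \<Longrightarrow> ell2_norm (R v) \<le> C1 * ell2_norm v"
    using z by (auto simp: jacobi_resolvent_set_def R_def)
  obtain C2 where C2: "\<And>v. v \<in> ell2 \<Longrightarrow> ell2_norm (Q v) \<le> C2 * ell2_norm v"
    using k by (auto simp: jacobi_resolvent_set_def Q_def)
  have "ell2_norm (S f) \<le> (4 * sqrt c * (\<bar>C2\<bar> * (\<bar>C1\<bar> * (4 * sqrt c)))) * ell2_norm f" if f: "f \<in> ell2" for f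
  proof -
    have "ell2_norm (R (L f)) \<le> C1 * ell2_norm (L f)" using f by (intro C1 L_ell2)
    also have "\<dots> \<le> \<bar>C1\<bar> * ell2_norm (L f)" by (intro mult_right_mono ell2_norm_nonneg) auto
    also have "\<dots> \<le> \<bar>C1\<bar> * (4 * sqrt c * ell2_norm f)" using f by (intro mult_left_mono L_ell2) auto
    finally have 1: "ell2_norm (R (L f)) \<le> \<bar>C1\<bar> * (4 * sqrt c * ell2_norm f)" .
    have "ell2_norm (Q (R (L f))) \<le> C2 * ell2_norm (R (L f))" using f by (intro C2 Rz(1) L_ell2)
    also have "\<dots> \<le> \<bar>C2\<bar> * ell2_norm (R (L f))" by (intro mult_right_mono ell2_norm_nonneg) auto
    also have "\<dots> \<le> \<bar>C2\<bar> * (\<bar>C1\<bar> * (4 * sqrt c * ell2_norm f))" by (intro mult_left_mono 1) auto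
    finally have 2: "ell2_norm (Q (R (L f))) \<le> \<bar>C2\<bar> * (\<bar>C1\<bar> * (4 * sqrt c * ell2_norm f))" .
    have "ell2_norm (S f) \<le> 4 * sqrt c * ell2_norm (Q (R (L f)))"
      unfolding S_def using f by (intro L'_ell2(2) Qk(1) Rz(1) L_ell2)
    also have "\<dots> \<le> 4 * sqrt c * (\<bar>C2\<bar> * (\<bar>C1\<bar> * (4 * sqrt c * ell2_norm f)))"
      using c_pos by (intro mult_left_mono 2) auto
    finally show ?thesis by (simp add: mult_ac)
  qed
  then show ?thesis unfolding jacobi_resolvent_set_def using bij res by auto
qed

text \<open>The two Weyl solutions of \<open>J\<close> at \<open>0\<close> are halves of \<open>u = (J - z)\<^sup>-\<^sup>1 \<delta>\<^sub>0\<close>; \<open>L\<^sup>*\<close> maps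
  them to Weyl solutions of \<open>J'\<close>, which are glued at \<open>0\<close>.\<close>

lemma H_function_J':
  assumes z: "z \<in> jacobi_resolvent_set J'" "Im z > 0"
    and u: "u \<in> ell2" "jacobi_shift J z u = delta 0" and u0: "u 0 \<noteq> 0"
    and qp: "qp = - of_real (a 0) * u 1 / u 0" and qm: "qm = (1 - of_real (a 0) * u 1) / u 0"
    and ne: "of_real (s 0) \<noteq> qp" "of_real (s 0) \<noteq> qm"
  shows "H_function J' z = (z - of_real \<kappa>) * of_real (s 0) * (1 / (of_real (s 0) - qp) - 1 / (of_real (s 0) - qm))"
proof -
  have zk: "z - of_real \<kappa> \<noteq> 0" using z(2) by (auto simp: complex_eq_iff)
  define f where "f = L' u"
  \<comment> \<open>\<open>f\<close> solves the equation of \<open>J'\<close> except at 0 and -1.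
    Its right half is a Weyl solution with value \<open>P\<close> at 0; its left half becomes one
    once the value at 0 is replaced by Q = P - 1 / x(0). Weighting the right half by
    \<open>Q\<close> and the left one by \<open>P\<close> makes them agree at 0, with value P
    Q.\<close>
  define P where "P = f 0"
  define Q where "Q = P - 1 / of_real (x 0)"
  have f_eq: "jacobi_shift J' z f = L' (delta 0)" unfolding f_def L'_shift[symmetric] u(2) ..
  have E: "of_real (y n * x (n + 1)) * f (n + 1) + of_real (y (n - 1) * x n) * f (n - 1)
      + of_real ((x n)\<^sup>2 + (y n)\<^sup>2 + \<kappa>) * f n - z * f n = (if n = 0 then of_real (x 0) else if n = -1 then of_real (y (-1)) else 0)" for n
  proof -
    have "L' (delta 0) n = (if n = 0 then of_real (x 0) else if n = -1 then of_real (y (-1)) else 0)"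
      by (auto simp: L'_def delta_def)
    then show ?thesis
      unfolding f_eq[symmetric] by (simp add: jacobi_shift_def jacobi_op_def J'_def)
  qed
  define w where "w n = (if n \<ge> 0 then Q else P) * f n" for n
  have w: "w \<in> ell2"
    unfolding w_def f_def by (rule ell2_weighted[where B = "max (cmod P) (cmod Q)"]) (auto intro!: L'_ell2 u)
  have x0: "complex_of_real (x 0) \<noteq> 0" using x_pos[of 0] by simp
  have PQ: "P - Q = 1 / of_real (x 0)" by (simp add: Q_def)
  have xP: "of_real (x 0) * P = of_real (s 0) * u 0 + of_real (a 0) * u 1"
  proof -
    have "of_real (x 0) * P = of_real ((x 0)\<^sup>2) * u 0 + of_real (x 0 * y 0) * u 1"
      by (simp add: P_def f_def L'_def power2_eq_square algebra_simps)
    then show ?thesis by (simp only: x_sq xy)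
  qed
  have xQ: "of_real (x 0) * Q = of_real (s 0) * u 0 + of_real (a 0) * u 1 - 1"
    using x0 by (simp add: Q_def right_diff_distrib xP)
  have sol0: "of_real (a 0) * u 1 + of_real (a (-1)) * u (-1) + of_real (b 0) * u 0 - z * u 0 = 1"
    using fun_cong[OF u(2), of 0] by (simp add: jacobi_shift_def jacobi_op_def J_def delta_def)
  have eqw: "of_real (y n * x (n + 1)) * w (n + 1) + of_real (y (n - 1) * x n) * w (n - 1)
      + of_real ((x n)\<^sup>2 + (y n)\<^sup>2 + \<kappa>) * w n - z * w n = (if n = 0 then (z - of_real \<kappa>) * u 0 else 0)" (is "?lhs n = _") for n
  proof -
    consider "n = 0" | "n = -1" | "n \<ge> 1" | "n \<le> -2" by linarith
    then show ?thesis
    proof cases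
      case 1
      have "?lhs 0 = Q * (of_real (y 0 * x (0 + 1)) * f (0 + 1) + of_real (y (0 - 1) * x 0) * f (0 - 1)
        + of_real ((x 0)\<^sup>2 + (y 0)\<^sup>2 + \<kappa>) * f 0 - z * f 0) + of_real (y (-1) * x 0) * (P - Q) * f (-1)"
        by (simp add: w_def algebra_simps)
      also have "\<dots> = of_real (x 0) * Q + of_real (y (-1)) * f (-1)"
        unfolding E PQ using x0 by simp
      also have "of_real (y (-1)) * f (-1) = of_real (a (-1)) * u (-1) + of_real ((y (-1))\<^sup>2) * u 0"
      proof -
        have "of_real (y (-1)) * f (-1) = of_real (x (-1) * y (-1)) * u (-1) + of_real ((y (-1))\<^sup>2) * u 0"
          by (simp add: f_def L'_def power2_eq_square algebra_simps)
        then show ?thesis by (simp only: xy)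
      qed
      also have "of_real (x 0) * Q + \<dots> = (z - of_real \<kappa>) * u 0"
      proof -
        have "complex_of_real (s 0) + of_real ((y (-1))\<^sup>2) = of_real (b 0) - of_real \<kappa>"
          using arg_cong[OF diag[of 0], of complex_of_real] by (simp add: x_sq flip: of_real_power)
        moreover have "of_real (x 0) * Q + (of_real (a (-1)) * u (-1) + of_real ((y (-1))\<^sup>2) * u 0)
          = (of_real (s 0) + of_real ((y (-1))\<^sup>2)) * u 0 + of_real (a 0) * u 1 + of_real (a (-1)) * u (-1) - 1"
          unfolding xQ by (simp add: algebra_simps)
        moreover have "(of_real (b 0) - of_real \<kappa>) * u 0 + of_real (a 0) * u 1 + of_real (a (-1)) * u (-1) - 1 = (z - of_real \<kappa>) * u 0"
          unfolding sol0[symmetric] by (simp add: algebra_simps)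
        ultimately show ?thesis by (simp only:)
      qed
      finally show ?thesis using 1 by simp
    next
      case 2
      have "?lhs (-1) = P * (of_real (y (-1) * x (-1 + 1)) * f (-1 + 1) + of_real (y (-1 - 1) * x (-1)) * f (-1 - 1)
        + of_real ((x (-1))\<^sup>2 + (y (-1))\<^sup>2 + \<kappa>) * f (-1) - z * f (-1)) - of_real (y (-1) * x 0) * (P - Q) * P"
        by (simp add: w_def P_def algebra_simps)
      also have "\<dots> = 0" unfolding E PQ using x0 by simp
      finally show ?thesis using 2 by simp
    next
      case 3
      then have "?lhs n = Q * (of_real (y n * x (n + 1)) * f (n + 1) + of_real (y (n - 1) * x n) * f (n - 1)
        + of_real ((x n)\<^sup>2 + (y n)\<^sup>2 + \<kappa>) * f n - z * f n)"
        by (simp add: w_def algebra_simps)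
      then show ?thesis unfolding E using 3 by simp
    next
      case 4
      then have "?lhs n = P * (of_real (y n * x (n + 1)) * f (n + 1) + of_real (y (n - 1) * x n) * f (n - 1)
        + of_real ((x n)\<^sup>2 + (y n)\<^sup>2 + \<kappa>) * f n - z * f n)"
        by (simp add: w_def algebra_simps)
      then show ?thesis unfolding E using 4 by simp
    qed
  qed
  define v where "v n = 1 / ((z - of_real \<kappa>) * u 0) * w n" for n
  have v: "v \<in> ell2" unfolding v_def by (rule ell2_cmult[OF w])
  have "jacobi_shift J' z v = delta 0"
  proof
    fix n
    have "jacobi_shift J' z v n = 1 / ((z - of_real \<kappa>) * u 0) *
      (of_real (y n * x (n + 1)) * w (n + 1) + of_real (y (n - 1) * x n) * w (n - 1)
      + of_real ((x n)\<^sup>2 + (y n)\<^sup>2 + \<kappa>) * w n - z * w n)"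
      by (simp add: jacobi_shift_def jacobi_op_def J'_def v_def algebra_simps)
    then show "jacobi_shift J' z v n = delta 0 n"
      unfolding eqw using zk u0 by (simp add: delta_def)
  qed
  then have "jacobi_resolvent J' z (delta 0) = v"
    using jacobi_resolvent_shift(3)[OF z(1) v] by simp
  then have "g0 J' z = v 0" by (rule g0_eq)
  then have H: "H_function J' z = - (z - of_real \<kappa>) * u 0 / (P * Q)"
  proof -
    have "v 0 = P * Q / ((z - of_real \<kappa>) * u 0)" by (simp add: v_def w_def P_def mult.commute)
    moreover have "- 1 / (p / (k * l)) = - k * l / p" for p k l :: complex by simp
    ultimately show ?thesis using \<open>g0 J' z = v 0\<close> by (simp only: H_function_def)
  qed
  have P: "of_real (x 0) * P = u 0 * (of_real (s 0) - qp)" unfolding xP qp using u0 by (simp add: field_simps)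
  have Q: "of_real (x 0) * Q = u 0 * (of_real (s 0) - qm)" unfolding xQ qm using u0 by (simp add: field_simps)
  have "of_real (s 0) * (P * Q) = (of_real (x 0) * P) * (of_real (x 0) * Q)"
    by (simp add: power2_eq_square mult_ac flip: x_sq)
  also have "\<dots> = (u 0)\<^sup>2 * ((of_real (s 0) - qp) * (of_real (s 0) - qm))"
    unfolding P Q by (simp add: power2_eq_square mult_ac)
  finally have PQ': "P * Q = (u 0)\<^sup>2 * ((of_real (s 0) - qp) * (of_real (s 0) - qm)) / of_real (s 0)"
    using s_pos[of 0] by (simp add: field_simps)
  \<comment> \<open>This difference turns the product formula for H into partial fractions in
    s(0).\<close>
  have q: "qp - qm = - 1 / u 0" using u0 by (simp add: qp qm field_simps)
  have d: "1 / (of_real (s 0) - qp) - 1 / (of_real (s 0) - qm) = (qp - qm) / ((of_real (s 0) - qp) * (of_real (s 0) - qm))"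
    using ne by (simp add: diff_frac_eq)
  have gen: "- k * v / (v\<^sup>2 * (A * B) / r) = k * r * (- 1 / v / (A * B))"
    if "v \<noteq> 0" "A \<noteq> 0" "B \<noteq> 0" "r \<noteq> 0" for k v A B r :: complex
    using that by (simp add: power2_eq_square)
  show ?thesis
    unfolding H PQ' d q by (rule gen) (use u0 ne s_pos[of 0] in auto)
qed


text \<open>Although \<open>s\<close> is large, its increments are of order M, because \<kappa>
  cancels between \<open>rec\<close> at neighbouring sites. Hence x(n + 1) - x(n), a difference of
  square roots, is of order M / sqrt c, and so is y(n), by which it is multiplied. The diagonal
  changes by a difference of two numbers in [0, M^2 / c].\<close>

lemma J'_close: "\<bar>fst J' n - a n\<bar> \<le> 4 * M\<^sup>2 / c" "\<bar>snd J' n - b n\<bar> \<le> 4 * M\<^sup>2 / c"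
proof -
  have M: "0 \<le> M" using a_nonneg[of 0] a_le[of 0] by linarith
  have q: "0 \<le> (a n)\<^sup>2 / s n" "(a n)\<^sup>2 / s n \<le> M\<^sup>2 / c" for n
    using a_nonneg[of n] a_le[of n] s_ge[of n] c_pos s_pos[of n] by (auto intro!: frac_le power_mono divide_nonneg_pos)
  have "snd J' n - b n = (a n)\<^sup>2 / s n - (a (n - 1))\<^sup>2 / s (n - 1)"
    using rec[of n] by (simp add: J'_def x_sq y_sq)
  moreover have "M\<^sup>2 / c \<le> 4 * M\<^sup>2 / c" using c_pos by (simp add: divide_right_mono)
  ultimately show "\<bar>snd J' n - b n\<bar> \<le> 4 * M\<^sup>2 / c"
    using q[of n] q[of "n - 1"] by arith
  have "M\<^sup>2 / c \<le> M" using M M_le c_pos by (simp add: divide_le_eq power2_eq_square mult_left_mono)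
  moreover have "s (n + 1) - s n = b (n + 1) - b n - (a n)\<^sup>2 / s n + (a (n - 1))\<^sup>2 / s (n - 1)"
    using rec[of n] rec[of "n + 1"] by simp
  ultimately have D: "\<bar>s (n + 1) - s n\<bar> \<le> 4 * M"
    using q[of n] q[of "n - 1"] b_le[of n] b_le[of "n + 1"] by arith
  have "fst J' n - a n = y n * (x (n + 1) - x n)"
    using xy[of n] by (simp add: J'_def algebra_simps)
  also have "\<dots> = a n * (s (n + 1) - s n) / (x n * (x (n + 1) + x n))"
  proof -
    have "v * (p - q) = (q * v) * (p\<^sup>2 - q\<^sup>2) / (q * (p + q))" if "0 < p" "0 < q" for p q v :: real
    proof -
      have "p\<^sup>2 - q\<^sup>2 = (p + q) * (p - q)" by (simp add: power2_eq_square algebra_simps)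
      then show ?thesis using that by simp
    qed
    from this[OF x_pos[of "n + 1"] x_pos[of n], of "y n"] show ?thesis by (simp only: x_sq xy)
  qed
  finally have "\<bar>fst J' n - a n\<bar> = a n * \<bar>s (n + 1) - s n\<bar> / (x n * (x (n + 1) + x n))"
    using a_nonneg[of n] x_pos[of n] x_pos[of "n + 1"] by (simp add: abs_mult)
  also have "\<dots> \<le> M * (4 * M) / c"
  proof (intro frac_le mult_mono a_le D)
    have "c \<le> (x n)\<^sup>2" by (simp add: x_sq s_ge)
    also have "\<dots> \<le> x n * (x (n + 1) + x n)"
      using x_pos[of n] x_pos[of "n + 1"] by (simp add: power2_eq_square)
    finally show "c \<le> x n * (x (n + 1) + x n)" .
  qed (use M c_pos in auto)
  finally show "\<bar>fst J' n - a n\<bar> \<le> 4 * M\<^sup>2 / c" by (simp add: power2_eq_square mult.left_commute)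
qed

end

section \<open>Existence of the factorization and convergence\<close>

lemma convergent_of_geometric_increments:
  fixes X :: "nat \<Rightarrow> real"
  assumes "\<And>k. \<bar>X (Suc k) - X k\<bar> \<le> C * (1 / 2) ^ k"
  shows "convergent X"
proof -
  have "summable (\<lambda>k. X (Suc k) - X k)"
  proof (rule summable_comparison_test')
    show "summable (\<lambda>k. C * (1 / 2) ^ k)" by (intro summable_mult summable_geometric) simp
    show "norm (X (Suc k) - X k) \<le> C * (1 / 2) ^ k" if "0 \<le> k" for k using assms[of k] by simp
  qed
  then have "convergent (\<lambda>n. \<Sum>k<n. X (Suc k) - X k)" by (simp add: summable_iff_convergent)
  then have "convergent (\<lambda>n. (\<Sum>k<n. X (Suc k) - X k) + X 0)" by (rule convergent_add) (rule convergent_const)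
  then show ?thesis by (simp add: sum_lessThan_telescope)
qed

text \<open>Solving the recursion at 0 for \<kappa> with s(0) = r and inserting the result at all
  sites leaves a fixed point equation for sequences near r. Its nonlinear part has derivatives of
  order (a / s)^2, so it is a contraction once r \<ge> 8 M.\<close>

lemma darboux_diagonal_exists:
  fixes a b :: "int \<Rightarrow> real"
  assumes M: "0 \<le> M" and a: "\<And>n. \<bar>a n\<bar> \<le> M" and b: "\<And>n. \<bar>b n\<bar> \<le> M" and r: "8 * M \<le> r" "0 < r"
  obtains s where "s 0 = r" "\<And>n. r / 2 \<le> s n" "\<And>n. s n \<le> 2 * r"
    "\<And>n. s n + (a (n - 1))\<^sup>2 / s (n - 1) = b n - (b 0 - r - (a (-1))\<^sup>2 / s (-1))"
proof -
  \<comment> \<open>At n = 0 everything but r cancels, so every fixed point satisfies s(0) =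
    r.\<close>
  define \<Phi> where "\<Phi> R n = r + b n - b 0 + (a (-1))\<^sup>2 / R (-1) - (a (n - 1))\<^sup>2 / R (n - 1)" for R :: "int \<Rightarrow> real" and n
  have a2: "(a n)\<^sup>2 \<le> M * r / 8" for n
  proof -
    have "(a n)\<^sup>2 \<le> M\<^sup>2" using power_mono[OF a[of n] abs_ge_zero, of 2] by simp
    also have "\<dots> \<le> M * (r / 8)" unfolding power2_eq_square using M r by (intro mult_left_mono) auto
    finally show ?thesis by simp
  qed
  have a3: "(a n)\<^sup>2 \<le> r\<^sup>2 / 64" for n
  proof -
    have "M * r / 8 \<le> (r / 8) * r / 8" using r by (intro divide_right_mono mult_right_mono) auto
    then show ?thesis using a2[of n] by (simp add: power2_eq_square)
  qed
  have inv: "\<bar>\<Phi> R n - r\<bar> \<le> r / 2" if R: "\<And>n. \<bar>R n - r\<bar> \<le> r / 2" for R n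
  proof -
    have "0 \<le> (a n)\<^sup>2 / R n \<and> (a n)\<^sup>2 / R n \<le> M / 4" for n
    proof -
      have "r / 2 \<le> R n" using R[of n] by arith
      then have "(a n)\<^sup>2 / R n \<le> (M * r / 8) / (r / 2)" using a2[of n] r M by (intro frac_le) auto
      then show ?thesis using r \<open>r / 2 \<le> R n\<close> by simp
    qed
    from this[of "-1"] this[of "n - 1"] show ?thesis
      unfolding \<Phi>_def using b[of n] b[of 0] r M by arith
  qed
  define R where "R k = (\<Phi> ^^ k) (\<lambda>_. r)" for k
  have R_inv: "\<bar>R k n - r\<bar> \<le> r / 2" for k n
  proof (induction k arbitrary: n)
    case (Suc k)
    then show ?case using inv[of "R k" n] by (simp add: R_def)
  qed (use r in \<open>simp add: R_def\<close>)
  have R_Suc: "R (Suc k) = \<Phi> (R k)" for k by (simp add: R_def)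
  have R_ge: "r / 2 \<le> R k n" and R_le: "R k n \<le> 2 * r" for k n using R_inv[of k n] r by arith+
  \<comment> \<open>The constant is (r^2 / 64) / (r / 2)^2. Two such terms occur in
    \<open>\<Phi>\<close>, so its Lipschitz constant is 1 / 8; the cruder factor 1 / 2 is enough
    below.\<close>
  have lip1: "\<bar>(a n)\<^sup>2 / u - (a n)\<^sup>2 / v\<bar> \<le> \<bar>u - v\<bar> / 16" if "r / 2 \<le> u" "r / 2 \<le> v" for n u v
  proof -
    have uv: "0 < u" "0 < v" using that r by auto
    have "(a n)\<^sup>2 / u - (a n)\<^sup>2 / v = (a n)\<^sup>2 * (v - u) / (u * v)" using uv by (simp add: field_simps)
    then have "\<bar>(a n)\<^sup>2 / u - (a n)\<^sup>2 / v\<bar> = (a n)\<^sup>2 * \<bar>u - v\<bar> / (u * v)"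
      using uv by (simp add: abs_mult abs_minus_commute)
    also have "\<dots> \<le> (r\<^sup>2 / 64) * \<bar>u - v\<bar> / (r / 2 * (r / 2))"
      using that r uv by (intro frac_le mult_right_mono mult_mono a3 mult_nonneg_nonneg) auto
    also have "\<dots> = \<bar>u - v\<bar> / 16" using r by (simp add: power2_eq_square)
    finally show ?thesis .
  qed
  have incr: "\<bar>R (Suc k) n - R k n\<bar> \<le> r / 2 * (1 / 2) ^ k" for k n
  proof (induction k arbitrary: n)
    case 0
    then show ?case using inv[of "\<lambda>_. r" n] r by (simp add: R_def)
  next
    case (Suc k)
    have "R (Suc (Suc k)) n - R (Suc k) n
      = ((a (-1))\<^sup>2 / R (Suc k) (-1) - (a (-1))\<^sup>2 / R k (-1)) - ((a (n - 1))\<^sup>2 / R (Suc k) (n - 1) - (a (n - 1))\<^sup>2 / R k (n - 1))"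
    proof -
      have "R (Suc (Suc k)) n - R (Suc k) n = \<Phi> (R (Suc k)) n - \<Phi> (R k) n" by (simp only: R_Suc)
      then show ?thesis by (simp only: \<Phi>_def)
    qed
    moreover have "\<bar>p - q\<bar> \<le> E / 2"
      if "\<bar>p\<bar> \<le> \<bar>v\<bar> / 16" "\<bar>q\<bar> \<le> \<bar>w\<bar> / 16" "\<bar>v\<bar> \<le> E" "\<bar>w\<bar> \<le> E" for p q v w E :: real
      using that by arith
    from this[OF lip1[OF R_ge R_ge] lip1[OF R_ge R_ge] Suc[of "-1"] Suc[of "n - 1"]]
    have "\<bar>((a (-1))\<^sup>2 / R (Suc k) (-1) - (a (-1))\<^sup>2 / R k (-1)) - ((a (n - 1))\<^sup>2 / R (Suc k) (n - 1) - (a (n - 1))\<^sup>2 / R k (n - 1))\<bar>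
      \<le> (r / 2 * (1 / 2) ^ k) / 2" .
    ultimately have "\<bar>R (Suc (Suc k)) n - R (Suc k) n\<bar> \<le> (r / 2 * (1 / 2) ^ k) / 2" by simp
    then show ?case by simp
  qed
  define s where "s n = lim (\<lambda>k. R k n)" for n
  have s: "(\<lambda>k. R k n) \<longlonglongrightarrow> s n" for n
    using convergent_of_geometric_increments[of "\<lambda>k. R k n", OF incr] by (simp add: s_def convergent_LIMSEQ_iff)
  have s_ge: "r / 2 \<le> s n" for n by (rule LIMSEQ_le_const[OF s]) (use R_ge in blast)
  have s_le: "s n \<le> 2 * r" for n by (rule LIMSEQ_le_const2[OF s]) (use R_le in blast)
  have s_ne: "s n \<noteq> 0" for n using s_ge[of n] r by auto
  have "(\<lambda>k. \<Phi> (R k) n) \<longlonglongrightarrow> \<Phi> s n" for n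
    unfolding \<Phi>_def by (intro tendsto_intros s s_ne)
  moreover have "(\<lambda>k. \<Phi> (R k) n) \<longlonglongrightarrow> s n" for n
    using LIMSEQ_Suc[OF s[of n]] by (simp add: R_Suc)
  ultimately have fp: "s n = \<Phi> s n" for n by (metis LIMSEQ_unique)
  show ?thesis
  proof
    show "s 0 = r" using fp[of 0] by (simp add: \<Phi>_def)
    show "s n + (a (n - 1))\<^sup>2 / s (n - 1) = b n - (b 0 - r - (a (-1))\<^sup>2 / s (-1))" for n
      using fp[of n] by (simp add: \<Phi>_def)
  qed (rule s_ge s_le)+
qed

section \<open>The weighted metric on Jacobi matrices\<close>

lemma int_weights_summable: "(\<lambda>n::int. 2 powi (- \<bar>n\<bar>) :: real) summable_on UNIV"
proof -
  have p: "2 powi (- \<bar>int k\<bar>) = (1 / 2 :: real) ^ k" for k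
    by (simp add: power_int_minus power_one_over inverse_eq_divide)
  have g: "(\<lambda>k::nat. (1 / 2 :: real) ^ k) summable_on UNIV"
    by (intro summable_nonneg_imp_summable_on summable_geometric) auto
  have "((\<lambda>n::int. 2 powi (- \<bar>n\<bar>) :: real) \<circ> int) summable_on UNIV"
    using g by (simp only: comp_def p)
  then have 1: "(\<lambda>n::int. 2 powi (- \<bar>n\<bar>) :: real) summable_on range int"
    by (subst summable_on_reindex) auto
  have "((\<lambda>n::int. 2 powi (- \<bar>n\<bar>) :: real) \<circ> (\<lambda>k. - int k)) summable_on UNIV"
    using g by (simp only: comp_def abs_minus_cancel p)
  then have 2: "(\<lambda>n::int. 2 powi (- \<bar>n\<bar>) :: real) summable_on range (\<lambda>k. - int k)"
    by (subst summable_on_reindex) (auto simp: inj_def)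
  have "n \<in> range int \<union> range (\<lambda>k. - int k)" for n :: int
    by (cases n rule: int_cases2) auto
  then have "(UNIV :: int set) = range int \<union> range (\<lambda>k. - int k)" by blast
  then show ?thesis using summable_on_union[OF 1 2] by simp
qed

lemma jacobi_dist_bound:
  assumes "\<And>n. \<bar>a n - a' n\<bar> \<le> e" "\<And>n. \<bar>b n - b' n\<bar> \<le> e"
  shows "0 \<le> jacobi_dist (a, b) (a', b')"
    and "jacobi_dist (a, b) (a', b') \<le> (\<Sum>\<^sub>\<infinity>n::int. 2 powi (- \<bar>n\<bar>)) * (2 * e)"
proof -
  show "0 \<le> jacobi_dist (a, b) (a', b')" unfolding jacobi_dist_def by (auto intro!: infsum_nonneg)
  have s: "(\<lambda>n::int. 2 powi (- \<bar>n\<bar>) * (2 * e)) summable_on UNIV"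
    by (rule summable_on_cmult_left[OF int_weights_summable])
  have le: "2 powi (- \<bar>n\<bar>) * (\<bar>a n - a' n\<bar> + \<bar>b n - b' n\<bar>) \<le> 2 powi (- \<bar>n\<bar>) * (2 * e)" for n
    using assms[of n] by (intro mult_left_mono) auto
  have "(\<Sum>\<^sub>\<infinity>n. 2 powi (- \<bar>n\<bar>) * (\<bar>a n - a' n\<bar> + \<bar>b n - b' n\<bar>)) \<le> (\<Sum>\<^sub>\<infinity>n::int. 2 powi (- \<bar>n\<bar>) * (2 * e))"
    by (intro infsum_mono s le summable_on_comparison_test[OF s]) auto
  also have "\<dots> = (\<Sum>\<^sub>\<infinity>n::int. 2 powi (- \<bar>n\<bar>)) * (2 * e)"
    by (intro infsum_cmult_left int_weights_summable)
  finally show "jacobi_dist (a, b) (a', b') \<le> (\<Sum>\<^sub>\<infinity>n::int. 2 powi (- \<bar>n\<bar>)) * (2 * e)"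
    by (simp add: jacobi_dist_def)
qed

text \<open>Cut the line into cells of one length e. The cells that meet K are disjoint and lie in a
  neighbourhood of K of measure at most \<eta>, so their number times e is at most \<eta>. The
  common radius later serves as the height at which H is evaluated, and the bounded distance to K
  keeps the centres in a fixed interval.\<close>

lemma compact_null_cover:
  fixes K :: "real set"
  assumes K: "compact K" "emeasure lborel K = 0" and \<eta>: "0 < \<eta>"
  obtains e X where "0 < e" "e \<le> 1" "finite X" "K \<subseteq> (\<Union>x\<in>X. ball x e)" "real (card X) * e \<le> \<eta>"
    "\<And>x. x \<in> X \<Longrightarrow> \<exists>t\<in>K. \<bar>x - t\<bar> \<le> 1"
proof -
  have "K \<in> sets borel" using K(1) by (simp add: compact_imp_closed)
  then have Kl: "K \<in> sets lebesgue" "emeasure lebesgue K = 0" using K(2) by (auto simp: emeasure_completion)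
  obtain U where U: "open U" "K \<subseteq> U" "emeasure lebesgue (U - K) < ennreal \<eta>"
    using sets_lebesgue_outer_open[OF Kl(1) \<eta>] by metis
  have Us: "U \<in> sets lebesgue" using U(1) by auto
  have "emeasure lebesgue ((U - K) \<union> K) \<le> emeasure lebesgue (U - K) + emeasure lebesgue K"
    by (intro emeasure_subadditive sets.Diff Us Kl(1))
  moreover have "(U - K) \<union> K = U" using U(2) by auto
  moreover have "emeasure lebesgue U = emeasure lborel U" using U(1) by (simp add: emeasure_completion)
  ultimately have Um0: "emeasure lborel U \<le> emeasure lebesgue (U - K)" using Kl(2) by simp
  have Um: "emeasure lborel U \<le> ennreal \<eta>"
    by (rule order.trans[OF Um0 less_imp_le[OF U(3)]])
  obtain e0 where e0: "0 < e0" "(\<Union>x\<in>K. ball x e0) \<subseteq> U"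
    using compact_subset_open_imp_ball_epsilon_subset[OF K(1) U(1,2)] by metis
  define e where "e = min e0 1"
  have e: "0 < e" "e \<le> 1" "e \<le> e0" using e0 by (auto simp: e_def)
  define Z where "Z = (\<lambda>t. \<lfloor>t / e\<rfloor>) ` K"
  have fl: "of_int \<lfloor>t / e\<rfloor> * e \<le> t" "t < of_int \<lfloor>t / e\<rfloor> * e + e" for t
    using floor_divide_lower[OF e(1), of t] floor_divide_upper[OF e(1), of t] by (simp_all add: algebra_simps)
  have finZ: "finite Z"
  proof -
    obtain B where B: "\<And>t. t \<in> K \<Longrightarrow> \<bar>t\<bar> \<le> B"
      using compact_imp_bounded[OF K(1)] by (auto simp: bounded_iff)
    have "\<lfloor>t / e\<rfloor> \<in> {\<lfloor>- B / e\<rfloor>..\<lfloor>B / e\<rfloor>}" if "t \<in> K" for t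
    proof -
      have "- B \<le> t" "t \<le> B" using B[OF that] by auto
      then show ?thesis
        using e(1) divide_right_mono[of "- B" t e] divide_right_mono[of t B e] by (auto intro!: floor_mono)
    qed
    then have "Z \<subseteq> {\<lfloor>- B / e\<rfloor>..\<lfloor>B / e\<rfloor>}" unfolding Z_def by blast
    then show ?thesis by (rule finite_subset) simp
  qed
  define I where "I k = {of_int k * e..<of_int k * e + e}" for k :: int
  have I_U: "(\<Union>k\<in>Z. I k) \<subseteq> U"
  proof -
    have "I \<lfloor>t / e\<rfloor> \<subseteq> ball t e0" for t
      using fl[of t] e by (auto simp: I_def dist_real_def)
    then show ?thesis using e0(2) by (fastforce simp: Z_def)
  qed
  have disj: "disjoint_family_on I Z"
  proof (unfold disjoint_family_on_def, intro ballI impI)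
    fix k l :: int assume "k \<noteq> l"
    have "False" if "t \<in> I k" "t \<in> I l" for t
    proof -
      have "\<lfloor>t / e\<rfloor> = k" "\<lfloor>t / e\<rfloor> = l"
        using that e(1) by (auto simp: I_def floor_eq_iff field_simps)
      with \<open>k \<noteq> l\<close> show False by simp
    qed
    then show "I k \<inter> I l = {}" by blast
  qed
  have "ennreal (real (card Z) * e) = (\<Sum>k\<in>Z. emeasure lborel (I k))"
    using e(1) by (simp add: I_def ennreal_mult ennreal_of_nat_eq_real_of_nat)
  also have "\<dots> = emeasure lborel (\<Union>k\<in>Z. I k)"
    by (rule sum_emeasure[OF _ disj finZ]) (auto simp: I_def)
  also have "\<dots> \<le> emeasure lborel U" using U(1) by (intro emeasure_mono I_U) auto
  also note Um
  finally have cZ: "real (card Z) * e \<le> \<eta>" using \<eta> by (simp add: ennreal_le_iff)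
  define X where "X = (\<lambda>k. of_int k * e) ` Z"
  show ?thesis
  proof
    show "0 < e" "e \<le> 1" by fact+
    show "finite X" using finZ by (simp add: X_def)
    show "K \<subseteq> (\<Union>x\<in>X. ball x e)"
    proof
      fix t assume "t \<in> K"
      then have "of_int \<lfloor>t / e\<rfloor> * e \<in> X" by (auto simp: X_def Z_def)
      moreover have "t \<in> ball (of_int \<lfloor>t / e\<rfloor> * e) e" using fl[of t] by (simp add: dist_real_def)
      ultimately show "t \<in> (\<Union>x\<in>X. ball x e)" by blast
    qed
    have "real (card X) * e \<le> real (card Z) * e"
      using e(1) card_image_le[OF finZ] by (intro mult_right_mono) (auto simp: X_def)
    then show "real (card X) * e \<le> \<eta>" using cZ by linarith
    show "\<exists>t\<in>K. \<bar>x - t\<bar> \<le> 1" if x: "x \<in> X" for x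
    proof -
      obtain t where "t \<in> K" "x = of_int \<lfloor>t / e\<rfloor> * e" using x by (auto simp: X_def Z_def)
      then show ?thesis using fl[of t] e(2) by (intro bexI[of _ t]) auto
    qed
  qed
qed

text \<open>The integrand is the Poisson kernel with centre Re q and width |Im q|, whose total mass
  is \<pi> for every non-real q. The averaging rests on this uniformity in q.\<close>

lemma nn_integral_Im_inverse_le:
  fixes q :: complex
  assumes "l \<le> h"
  shows "(\<integral>\<^sup>+r. ennreal \<bar>Im (1 / (of_real r - q))\<bar> * indicator {l..h} r \<partial>lborel) \<le> ennreal pi"
proof (cases "Im q = 0")
  case True
  then have "Im (1 / (of_real r - q)) = 0" for r :: real by (simp add: Im_divide)
  then show ?thesis by simp
next
  case False
  define w where "w = \<bar>Im q\<bar>"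
  have w: "w > 0" using False by (simp add: w_def)
  have eq: "\<bar>Im (1 / (of_real r - q))\<bar> = w / ((r - Re q)\<^sup>2 + w\<^sup>2)" for r :: real
    by (simp add: Im_divide w_def abs_divide)
  define F where "F r = arctan ((r - Re q) / w)" for r
  have "(\<integral>\<^sup>+r. ennreal (w / ((r - Re q)\<^sup>2 + w\<^sup>2)) * indicator {l..h} r \<partial>lborel) = ennreal (F h - F l)"
  proof (rule nn_integral_FTC_Icc)
    show "(F has_real_derivative w / ((r - Re q)\<^sup>2 + w\<^sup>2)) (at r)" for r
    proof -
      have "(F has_field_derivative inverse (1 + ((r - Re q) / w)\<^sup>2) * (1 / w)) (at r)"
        unfolding F_def using w by (auto intro!: derivative_eq_intros)
      moreover have "inverse (1 + ((r - Re q) / w)\<^sup>2) * (1 / w) = w / ((r - Re q)\<^sup>2 + w\<^sup>2)"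
      proof -
        have "1 + ((r - Re q) / w)\<^sup>2 = ((r - Re q)\<^sup>2 + w\<^sup>2) / w\<^sup>2" using w by (simp add: power_divide field_simps)
        then show ?thesis using w by (simp add: power2_eq_square)
      qed
      ultimately show ?thesis by simp
    qed
  qed (use assms w in auto)
  also have "\<dots> \<le> ennreal pi"
    using arctan_bounded[of "(h - Re q) / w"] arctan_bounded[of "(l - Re q) / w"]
    by (intro ennreal_leI) (simp add: F_def)
  finally show ?thesis by (simp only: eq)
qed

section \<open>Spectral averaging\<close>

text \<open>By the signs of Im q+ and Im q-, both terms of the main part are nonnegative, so the
  absolute values cost nothing. The remainder is y = Im z times real parts and needs y / |s(0) - q|
  bounded for q = q+ and q = q-. For q- this follows from Im q- \<le> - y.\<close>

lemma (in darboux) Im_H_function_J'_le: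
  assumes z: "z \<in> jacobi_resolvent_set J'" "0 < Im z" "Im z \<le> 1" and s0: "1 \<le> s 0"
    and u: "u \<in> ell2" "jacobi_shift J z u = delta 0"
    and qp: "qp = - of_real (a 0) * u 1 / u 0" and qm: "qm = (1 - of_real (a 0) * u 1) / u 0"
    and B1: "(Re z - \<kappa>) * s 0 \<le> B1" and B2: "s 0 * (3 + 4 * M\<^sup>2) \<le> B2"
  shows "Im (H_function J' z) \<le> B1 * (\<bar>Im (1 / (of_real (s 0) - qp))\<bar> + \<bar>Im (1 / (of_real (s 0) - qm))\<bar>) + B2"
proof -
  define y where "y = Im z"
  have y: "0 < y" "y \<le> 1" using z by (auto simp: y_def)
  note green = J_in[unfolded J_def] z(2) u[unfolded J_def]
  have u0: "u 0 \<noteq> 0" by (rule green_nonzero[OF green])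
  then have n0: "0 < (cmod (u 0))\<^sup>2" by simp
  have Im_div: "Im (w / u 0) = Im (w * cnj (u 0)) / (cmod (u 0))\<^sup>2" for w
    by (subst complex_div_cnj) (simp flip: of_real_power)
  define G where "G = Im (of_real (a 0) * cnj (u 0) * u 1)"
  have "Im qp = - G / (cmod (u 0))\<^sup>2" unfolding qp Im_div G_def by (simp add: algebra_simps)
  moreover have "y * (cmod (u 1))\<^sup>2 / (cmod (u 0))\<^sup>2 \<le> - G / (cmod (u 0))\<^sup>2"
    using green_right[OF green] by (intro divide_right_mono) (auto simp: y_def G_def)
  ultimately have Imqp: "y * (cmod (u 1))\<^sup>2 / (cmod (u 0))\<^sup>2 \<le> Im qp"
    by (simp only:)
  have "Im qm = (- Im (u 0) - G) / (cmod (u 0))\<^sup>2" unfolding qm Im_div G_def by (simp add: algebra_simps)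
  moreover have "- Im (u 0) - G \<le> - y * (cmod (u 0))\<^sup>2" using green_left[OF green] by (simp add: y_def G_def)
  ultimately have Imqm: "Im qm \<le> - y"
    using n0 by (simp add: divide_le_eq)
  have Imqp0: "0 \<le> Im qp"
    by (rule order.trans[OF _ Imqp]) (use y in auto)
  have norm_qp: "y * (cmod qp)\<^sup>2 \<le> M\<^sup>2 * Im qp"
  proof -
    have "y * (cmod qp)\<^sup>2 = (a 0)\<^sup>2 * (y * (cmod (u 1))\<^sup>2 / (cmod (u 0))\<^sup>2)"
      unfolding qp by (simp add: norm_divide norm_mult power_mult_distrib power_divide)
    also have "\<dots> \<le> M\<^sup>2 * Im qp"
      using a_nonneg[of 0] a_le[of 0] y by (intro mult_mono power_mono Imqp) auto
    finally show ?thesis .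
  qed
  define D where "D = complex_of_real (s 0) - qp"
  define E where "E = complex_of_real (s 0) - qm"
  have ImD: "Im D = - Im qp" and ImE: "y \<le> Im E" using Imqm by (auto simp: D_def E_def)
  have E0: "E \<noteq> 0" using ImE y by auto
  \<comment> \<open>Im q+ may be far smaller than y. If |q+| > s(0) / 2, then y / 4 \<le> y |q+|^2
    \<le> M^2 Im q+ saves the bound; otherwise q+ has distance at least 1 / 2 from s(0).\<close>
  have far: "s 0 / 2 < cmod qp \<Longrightarrow> y \<le> 4 * M\<^sup>2 * cmod D"
  proof -
    assume "s 0 / 2 < cmod qp"
    then have "(1 / 2)\<^sup>2 \<le> (cmod qp)\<^sup>2" using s0 by (intro power_mono) auto
    then have "y * (1 / 2)\<^sup>2 \<le> y * (cmod qp)\<^sup>2" using y by (intro mult_left_mono) auto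
    also note norm_qp
    also have "M\<^sup>2 * Im qp \<le> M\<^sup>2 * cmod D"
      using abs_Im_le_cmod[of D] ImD Imqp0 by (intro mult_left_mono) auto
    finally show ?thesis by (simp add: power2_eq_square)
  qed
  have near: "1 / 2 \<le> cmod D" if "cmod qp \<le> s 0 / 2"
    using norm_triangle_ineq2[of "complex_of_real (s 0)" qp] that s0 by (simp add: D_def)
  have D0: "D \<noteq> 0"
  proof
    assume "D = 0"
    then show False using near far y by (cases "cmod qp \<le> s 0 / 2") auto
  qed
  have yD: "y * cmod (1 / D) \<le> 2 + 4 * M\<^sup>2"
  proof (cases "cmod qp \<le> s 0 / 2")
    case True
    then have "y * 1 \<le> 2 * cmod D" using near y by simp
    then have "y / cmod D \<le> 2" using D0 by (simp add: divide_le_eq)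
    then show ?thesis by (simp add: norm_divide add_increasing2)
  next
    case False
    then have "y / cmod D \<le> 4 * M\<^sup>2" using far D0 by (simp add: divide_le_eq)
    then show ?thesis by (simp add: norm_divide)
  qed
  have yE: "y * cmod (1 / E) \<le> 1"
    using abs_Im_le_cmod[of E] ImE y E0 by (simp add: norm_divide divide_le_eq)
  have Im_inv: "Im (1 / w) = - Im w / (cmod w)\<^sup>2" for w :: complex
    by (simp add: Im_divide cmod_power2)
  have ID: "0 \<le> Im (1 / D)" and IE: "Im (1 / E) \<le> 0"
    unfolding Im_inv ImD using Imqp0 ImE y by (auto simp: divide_le_eq)
  have "H_function J' z = (z - of_real \<kappa>) * of_real (s 0) * (1 / D - 1 / E)"
    unfolding D_def E_def using D0 E0 by (intro H_function_J'[OF z(1,2) u u0 qp qm]) (auto simp: D_def E_def)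
  moreover have "Im ((w - of_real k) * of_real t * (p - q)) = (Re w - k) * t * (Im p - Im q) + t * (Im w * (Re p - Re q))"
    for w p q :: complex and k t :: real
    by (simp add: algebra_simps)
  ultimately have "Im (H_function J' z) = (Re z - \<kappa>) * s 0 * (Im (1 / D) - Im (1 / E)) + s 0 * (y * (Re (1 / D) - Re (1 / E)))"
    unfolding y_def by simp
  also have "\<dots> \<le> B1 * (Im (1 / D) - Im (1 / E)) + s 0 * (3 + 4 * M\<^sup>2)"
  proof (intro add_mono mult_right_mono mult_left_mono B1)
    have "Re (1 / D) - Re (1 / E) \<le> cmod (1 / D) + cmod (1 / E)"
      using abs_Re_le_cmod[of "1 / D"] abs_Re_le_cmod[of "1 / E"] by arith
    then have "y * (Re (1 / D) - Re (1 / E)) \<le> y * (cmod (1 / D) + cmod (1 / E))"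
      using y by (intro mult_left_mono) auto
    then show "y * (Re (1 / D) - Re (1 / E)) \<le> 3 + 4 * M\<^sup>2"
      using yD yE unfolding distrib_left by linarith
  qed (use ID IE s0 in auto)
  also have "Im (1 / D) - Im (1 / E) = \<bar>Im (1 / D)\<bar> + \<bar>Im (1 / E)\<bar>" using ID IE by simp
  finally show ?thesis using B2 by (simp add: D_def E_def)
qed

lemma nn_integral_kernel_le:
  fixes q1 q2 :: complex
  assumes "0 \<le> A" "0 \<le> B"
  shows "(\<integral>\<^sup>+r. ennreal (A * (\<bar>Im (1 / (of_real r - q1))\<bar> + \<bar>Im (1 / (of_real r - q2))\<bar>) + B) * indicator {l..l + 1} r \<partial>lborel)
    \<le> ennreal (A * (2 * pi) + B)"
proof -
  define f where "f q r = ennreal \<bar>Im (1 / (of_real r - q))\<bar> * indicator {l..l + 1} r" for q and r :: real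
  have [measurable]: "f q \<in> borel_measurable borel" for q unfolding f_def by measurable
  have "(\<integral>\<^sup>+r. ennreal (A * (\<bar>Im (1 / (of_real r - q1))\<bar> + \<bar>Im (1 / (of_real r - q2))\<bar>) + B) * indicator {l..l + 1} r \<partial>lborel)
    = (\<integral>\<^sup>+r. ennreal A * f q1 r + ennreal A * f q2 r + ennreal B * indicator {l..l + 1} r \<partial>lborel)"
    using assms by (intro nn_integral_cong)
      (auto simp: f_def ennreal_plus ennreal_mult distrib_left split: split_indicator simp del: ennreal_plus[symmetric])
  also have "\<dots> = ennreal A * (\<integral>\<^sup>+r. f q1 r \<partial>lborel) + ennreal A * (\<integral>\<^sup>+r. f q2 r \<partial>lborel) + ennreal B * emeasure lborel {l..l + 1}"
    by (simp add: nn_integral_add nn_integral_cmult nn_integral_cmult_indicator)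
  also have "\<dots> \<le> ennreal A * ennreal pi + ennreal A * ennreal pi + ennreal B * 1"
    unfolding f_def by (intro add_mono mult_left_mono nn_integral_Im_inverse_le) auto
  also have "\<dots> = ennreal (A * (2 * pi) + B)"
    using assms by (simp add: ennreal_mult[symmetric] ennreal_plus[symmetric] del: ennreal_plus)
  finally show ?thesis .
qed

text \<open>Spectral averaging: the measures \<open>\<rho>\<close> of the commuted matrices, averaged over the
  parameter \<open>r = s 0\<close>, are absolutely continuous, because
  \<open>\<integral> Im (1 / (r - q)) dr \<le> \<pi>\<close> for every \<open>q\<close>.\<close>

lemma exists_darboux_null:
  fixes K :: "real set" and a b :: "int \<Rightarrow> real"
  assumes K: "compact K" "emeasure lborel K = 0" and J: "(a, b) \<in> R0 K"
    and M: "0 \<le> M" "\<And>n. \<bar>a n\<bar> \<le> M" "\<And>n. \<bar>b n\<bar> \<le> M"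
    and B: "\<And>t. t \<in> K \<Longrightarrow> \<bar>t\<bar> \<le> B" and l: "1 \<le> l" "8 * M \<le> l" "M + B < l"
  shows "\<exists>J' \<rho>. J' \<in> R0 K \<and> associated_measure J' \<rho> \<and> emeasure \<rho> K = 0 \<and>
    (\<forall>n. \<bar>fst J' n - a n\<bar> \<le> 8 * M\<^sup>2 / l) \<and> (\<forall>n. \<bar>snd J' n - b n\<bar> \<le> 8 * M\<^sup>2 / l)"
proof -
  have Jm: "(a, b) \<in> jacobi_matrices" and Js: "z \<notin> of_real ` K \<Longrightarrow> z \<in> jacobi_resolvent_set (a, b)" for z
    using J by (auto simp: R0_def jacobi_spectrum_def)
  have a0: "0 \<le> a n" for n using Jm by (simp add: jacobi_matrices_def)
  have "\<exists>s. s 0 = r \<and> (\<forall>n. r / 2 \<le> s n \<and> s n \<le> 2 * r \<and>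
      s n + (a (n - 1))\<^sup>2 / s (n - 1) = b n - (b 0 - r - (a (-1))\<^sup>2 / s (-1)))" if "r \<in> {l..l + 1}" for r
    using darboux_diagonal_exists[of M a b r] M l that by (auto intro: order.trans) metis
  then obtain S where S: "\<And>r. r \<in> {l..l + 1} \<Longrightarrow> S r 0 = r"
    "\<And>r n. r \<in> {l..l + 1} \<Longrightarrow> r / 2 \<le> S r n" "\<And>r n. r \<in> {l..l + 1} \<Longrightarrow> S r n \<le> 2 * r"
    "\<And>r n. r \<in> {l..l + 1} \<Longrightarrow> S r n + (a (n - 1))\<^sup>2 / S r (n - 1) = b n - (b 0 - r - (a (-1))\<^sup>2 / S r (-1))"
    by metis
  define \<kappa> where "\<kappa> r = b 0 - r - (a (-1))\<^sup>2 / S r (-1)" for r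
  have D: "darboux a b (S r) (\<kappa> r) (r / 2) M" if r: "r \<in> {l..l + 1}" for r
    using S[OF r] a0 M l r by unfold_locales (auto simp: \<kappa>_def abs_le_iff)
  define JJ where "JJ r = darboux.J' a (S r) (\<kappa> r)" for r
  \<comment> \<open>The lower bound keeps the factor (Re z - \<kappa>) r under \<open>B1\<close>.
    The second claim comes from \<kappa> \<le> M - l < - B, which puts \<kappa> to the left of
    K.\<close>
  have \<kappa>: "- (2 * M + l + 1) \<le> \<kappa> r" "of_real (\<kappa> r) \<notin> complex_of_real ` K" if r: "r \<in> {l..l + 1}" for r
  proof -
    have "(a (-1))\<^sup>2 / S r (-1) \<le> M\<^sup>2 / (r / 2)"
      using S(2)[OF r, of "-1"] r l a0[of "-1"] M(2)[of "-1"] by (intro frac_le power_mono) auto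
    also have "\<dots> \<le> M"
    proof -
      have "M * M \<le> M * (r / 2)" using r l M(1) by (intro mult_left_mono) auto
      then show ?thesis using r l by (simp add: divide_le_eq power2_eq_square)
    qed
    finally have "(a (-1))\<^sup>2 / S r (-1) \<le> M" .
    moreover have "0 \<le> (a (-1))\<^sup>2 / S r (-1)"
      using S(2)[OF r, of "-1"] r l by (intro divide_nonneg_nonneg) auto
    ultimately have "- (2 * M + l + 1) \<le> \<kappa> r" "\<kappa> r < - B"
      using M(3)[of 0] r l by (auto simp: \<kappa>_def abs_le_iff)
    then show "- (2 * M + l + 1) \<le> \<kappa> r" and "of_real (\<kappa> r) \<notin> complex_of_real ` K"
      using B[of "\<kappa> r"] by auto
  qed
  have JJ_R0: "JJ r \<in> R0 K" if r: "r \<in> {l..l + 1}" for r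
  proof -
    interpret darboux a b "S r" "\<kappa> r" "r / 2" M by (rule D[OF r])
    have "z \<in> jacobi_resolvent_set J'" if "z \<notin> of_real ` K" for z
      using resolvent_set_transfer[of z] Js[OF that] Js[OF \<kappa>(2)[OF r]] by (simp add: J_def)
    then show ?thesis using J'_in by (auto simp: R0_def jacobi_spectrum_def JJ_def)
  qed
  have res: "z \<in> jacobi_resolvent_set (JJ r)" if "r \<in> {l..l + 1}" "0 < Im z" for r z
    using JJ_R0[OF that(1)] that(2) by (auto simp: R0_def jacobi_spectrum_def)
  have "\<exists>\<rho>. associated_measure (JJ r) \<rho>" if r: "r \<in> {l..l + 1}" for r
    using JJ_R0[OF r] res[OF r] by (intro associated_measure_exists) (auto simp: R0_def)
  then obtain \<rho> where \<rho>: "\<And>r. r \<in> {l..l + 1} \<Longrightarrow> associated_measure (JJ r) (\<rho> r)" by metis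
  define u where "u z = jacobi_resolvent (a, b) z (delta 0)" for z
  define qp where "qp z = - of_real (a 0) * u z 1 / u z 0" for z
  define qm where "qm z = (1 - of_real (a 0) * u z 1) / u z 0" for z
  define \<Psi> where "\<Psi> z r = \<bar>Im (1 / (of_real r - qp z))\<bar> + \<bar>Im (1 / (of_real r - qm z))\<bar>" for z r
  \<comment> \<open>Re z will be the centre of a ball, at most |B| + 1; - \<kappa> is at most 2 M +
    l + 1, and r at most l + 1.\<close>
  define B1 where "B1 = (\<bar>B\<bar> + 1 + (2 * M + l + 1)) * (l + 1)"
  define B2 where "B2 = (l + 1) * (3 + 4 * M\<^sup>2)"
  have B12: "0 \<le> B1" "0 \<le> B2" using M l by (auto simp: B1_def B2_def)
  have ball: "emeasure (\<rho> r) (ball x e) \<le> ennreal (2 * e * B1 * \<Psi> (Complex x e) r + 2 * e * B2)"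
    if r: "r \<in> {l..l + 1}" and x: "\<bar>x\<bar> \<le> \<bar>B\<bar> + 1" and e: "0 < e" "e \<le> 1" for r x e
  proof -
    interpret darboux a b "S r" "\<kappa> r" "r / 2" M by (rule D[OF r])
    have z: "Complex x e \<notin> of_real ` K" using e by (auto simp: complex_eq_iff)
    have "Im (H_function J' (Complex x e)) \<le> B1 * (\<bar>Im (1 / (of_real (S r 0) - qp (Complex x e)))\<bar> + \<bar>Im (1 / (of_real (S r 0) - qm (Complex x e)))\<bar>) + B2"
    proof (rule Im_H_function_J'_le)
      show "Complex x e \<in> jacobi_resolvent_set J'" using res[OF r, of "Complex x e"] e by (simp add: JJ_def)
      show "u (Complex x e) \<in> ell2" "jacobi_shift J (Complex x e) (u (Complex x e)) = delta 0"
        using jacobi_resolvent_shift[OF Js[OF z]] delta_in_ell2 by (auto simp: u_def J_def)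
      have "(Re (Complex x e) - \<kappa> r) * S r 0 \<le> (\<bar>B\<bar> + 1 + (2 * M + l + 1)) * S r 0"
        using x \<kappa>(1)[OF r] S(1)[OF r] r l by (intro mult_right_mono) auto
      also have "\<dots> \<le> B1" unfolding B1_def using S(1)[OF r] r l M by (intro mult_left_mono) auto
      finally show "(Re (Complex x e) - \<kappa> r) * S r 0 \<le> B1" .
      show "S r 0 * (3 + 4 * M\<^sup>2) \<le> B2" unfolding B2_def using S(1)[OF r] r by (intro mult_right_mono) auto
    qed (use e S(1)[OF r] r l in \<open>auto simp: qp_def qm_def\<close>)
    then have "2 * e * Im (H_function (JJ r) (Complex x e)) \<le> 2 * e * (B1 * \<Psi> (Complex x e) r + B2)"
      using e by (intro mult_left_mono) (auto simp: JJ_def \<Psi>_def S(1)[OF r])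
    with associated_measure_ball_le[OF \<rho>[OF r] e(1), of x]
    have "measure (\<rho> r) (ball x e) \<le> 2 * e * B1 * \<Psi> (Complex x e) r + 2 * e * B2"
      by (simp add: algebra_simps)
    moreover have "finite_measure (\<rho> r)" using \<rho>[OF r] by (simp add: associated_measure_def)
    ultimately show ?thesis by (simp add: finite_measure.emeasure_eq_measure ennreal_leI)
  qed
  have "\<exists>e X. 0 < e \<and> e \<le> 1 \<and> finite X \<and> K \<subseteq> (\<Union>x\<in>X. ball x e) \<and> real (card X) * e \<le> 1 / real (Suc k) \<and> (\<forall>x\<in>X. \<bar>x\<bar> \<le> \<bar>B\<bar> + 1)" for k
  proof -
    obtain e X where eX: "0 < e" "e \<le> 1" "finite X" "K \<subseteq> (\<Union>x\<in>X. ball x e)" "real (card X) * e \<le> 1 / real (Suc k)"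
      "\<And>x. x \<in> X \<Longrightarrow> \<exists>t\<in>K. \<bar>x - t\<bar> \<le> 1"
      using compact_null_cover[OF K, of "1 / real (Suc k)"] by auto
    have "\<bar>x\<bar> \<le> \<bar>B\<bar> + 1" if x: "x \<in> X" for x
    proof -
      obtain t where "t \<in> K" "\<bar>x - t\<bar> \<le> 1" using eX(6)[OF x] by auto
      then show ?thesis using B[of t] by arith
    qed
    then show ?thesis using eX(1-5) by blast
  qed
  then obtain e X where eX: "\<And>k. 0 < e k" "\<And>k. e k \<le> 1" "\<And>k. finite (X k)" "\<And>k. K \<subseteq> (\<Union>x\<in>X k. ball x (e k))"
      "\<And>k. real (card (X k)) * e k \<le> 1 / real (Suc k)" "\<And>k x. x \<in> X k \<Longrightarrow> \<bar>x\<bar> \<le> \<bar>B\<bar> + 1"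
    by metis
  \<comment> \<open>A majorant of the mass of K under \<open>\<rho> r\<close> that depends on r only
    through explicit formulas and hence is Borel; \<open>\<rho> r\<close> itself is chosen
    separately for each r.\<close>
  define g where "g k r = (\<Sum>x\<in>X k. ennreal (2 * e k * B1 * \<Psi> (Complex x (e k)) r + 2 * e k * B2) * indicator {l..l + 1} r)" for k r
  have [measurable]: "g k \<in> borel_measurable borel" for k unfolding g_def \<Psi>_def by measurable
  define C where "C = 2 * (B1 * (2 * pi) + B2)"
  have C: "0 \<le> C" using B12 by (simp add: C_def)
  have g_int: "(\<integral>\<^sup>+r. g k r \<partial>lborel) \<le> ennreal (C * (1 / real (Suc k)))" for k
  proof -
    have "(\<integral>\<^sup>+r. g k r \<partial>lborel) = (\<Sum>x\<in>X k. \<integral>\<^sup>+r. ennreal (2 * e k * B1 * \<Psi> (Complex x (e k)) r + 2 * e k * B2) * indicator {l..l + 1} r \<partial>lborel)"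
      unfolding g_def by (rule nn_integral_sum) (unfold \<Psi>_def, measurable)
    also have "\<dots> \<le> (\<Sum>x\<in>X k. ennreal (2 * e k * B1 * (2 * pi) + 2 * e k * B2))"
      unfolding \<Psi>_def using B12 eX(1)[of k] by (intro sum_mono nn_integral_kernel_le) auto
    also have "\<dots> = ennreal (real (card (X k)) * (2 * e k * B1 * (2 * pi) + 2 * e k * B2))"
      using B12 eX(1)[of k] by (simp add: ennreal_mult ennreal_of_nat_eq_real_of_nat)
    also have "real (card (X k)) * (2 * e k * B1 * (2 * pi) + 2 * e k * B2) = C * (real (card (X k)) * e k)"
      by (simp add: C_def algebra_simps)
    also have "ennreal \<dots> \<le> ennreal (C * (1 / real (Suc k)))"
      by (intro ennreal_leI mult_left_mono eX(5) C)
    finally show ?thesis .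
  qed
  \<comment> \<open>The infimum still dominates the mass of K for every r in the interval, and its
    integral is at most C / (k + 1) for all k, hence 0.\<close>
  define h where "h r = (INF k. g k r)" for r
  have [measurable]: "h \<in> borel_measurable borel" unfolding h_def by measurable
  have "(\<integral>\<^sup>+r. h r \<partial>lborel) \<le> 0"
  proof (rule LIMSEQ_le_const)
    have "(\<lambda>k. ennreal (C * (1 / real (Suc k)))) \<longlonglongrightarrow> ennreal (C * 0)"
      by (intro tendsto_ennrealI tendsto_mult_left) (use lim_1_over_n LIMSEQ_Suc in \<open>auto dest: LIMSEQ_Suc\<close>)
    then show "(\<lambda>k. ennreal (C * (1 / real (Suc k)))) \<longlonglongrightarrow> 0" by simp
    have "(\<integral>\<^sup>+r. h r \<partial>lborel) \<le> ennreal (C * (1 / real (Suc k)))" for k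
      by (rule order.trans[OF nn_integral_mono g_int]) (auto simp: h_def intro: INF_lower)
    then show "\<exists>N. \<forall>k\<ge>N. (\<integral>\<^sup>+r. h r \<partial>lborel) \<le> ennreal (C * (1 / real (Suc k)))" by blast
  qed
  then have "(\<integral>\<^sup>+r. h r \<partial>lborel) = 0" by simp
  then have h0: "AE r in lborel. h r = 0" by (subst (asm) nn_integral_0_iff_AE) auto
  have "\<exists>r\<in>{l..l + 1}. emeasure (\<rho> r) K = 0"
  proof (rule ccontr)
    assume neg: "\<not> ?thesis"
    have h_ne: "h r \<noteq> 0" if r: "r \<in> {l..l + 1}" for r
    proof -
      have sets: "sets (\<rho> r) = sets borel" using \<rho>[OF r] by (simp add: associated_measure_def)
      have "emeasure (\<rho> r) K \<le> g k r" for k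
      proof -
        have "emeasure (\<rho> r) K \<le> emeasure (\<rho> r) (\<Union>x\<in>X k. ball x (e k))"
          by (rule emeasure_mono[OF eX(4)]) (auto simp: sets intro!: borel_open)
        also have "\<dots> \<le> (\<Sum>x\<in>X k. emeasure (\<rho> r) (ball x (e k)))"
          using eX(3) by (intro emeasure_subadditive_finite) (auto simp: sets)
        also have "\<dots> \<le> (\<Sum>x\<in>X k. ennreal (2 * e k * B1 * \<Psi> (Complex x (e k)) r + 2 * e k * B2))"
          using eX by (intro sum_mono ball r) auto
        finally show ?thesis using r by (simp add: g_def)
      qed
      then have "emeasure (\<rho> r) K \<le> h r" unfolding h_def by (intro INF_greatest)
      then show ?thesis using neg r by auto
    qed
    have "AE r in lborel. r \<notin> {l..l + 1}" by (rule eventually_mono[OF h0]) (use h_ne in blast)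
    then have "emeasure lborel {l..l + 1} = 0"
      by (subst (asm) AE_iff_measurable[of "{l..l + 1}"]) auto
    then show False by simp
  qed
  then obtain r where r: "r \<in> {l..l + 1}" "emeasure (\<rho> r) K = 0" by blast
  interpret darboux a b "S r" "\<kappa> r" "r / 2" M by (rule D[OF r(1)])
  have "4 * M\<^sup>2 / (r / 2) \<le> 8 * M\<^sup>2 / l" using r l by (simp add: frac_le)
  then have "\<forall>n. \<bar>fst (JJ r) n - a n\<bar> \<le> 8 * M\<^sup>2 / l" "\<forall>n. \<bar>snd (JJ r) n - b n\<bar> \<le> 8 * M\<^sup>2 / l"
    using J'_close order.trans unfolding JJ_def by blast+
  then show ?thesis using JJ_R0[OF r(1)] \<rho>[OF r(1)] r(2) by blast
qed

theorem theorem6p1: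
  fixes K :: "real set" and J :: jacobi
  assumes "K \<noteq> {}" and "compact K" and "emeasure lborel K = 0"
    and "J \<in> R0 K"
  shows "\<exists>(Jn :: nat \<Rightarrow> jacobi) (\<rho> :: nat \<Rightarrow> real measure).
           (\<forall>n. Jn n \<in> R0 K \<and> associated_measure (Jn n) (\<rho> n) \<and> emeasure (\<rho> n) K = 0) \<and>
           (\<lambda>n. jacobi_dist (Jn n) J) \<longlonglongrightarrow> 0"
proof -
  have "J \<in> jacobi_matrices" using assms(4) by (simp add: R0_def)
  then obtain a b M where J: "J = (a, b)" and M: "0 \<le> M" "\<And>n. \<bar>a n\<bar> \<le> M" "\<And>n. \<bar>b n\<bar> \<le> M"
    by (blast elim: jacobi_matricesE)
  obtain B where B: "\<And>t. t \<in> K \<Longrightarrow> \<bar>t\<bar> \<le> B"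
    using compact_imp_bounded[OF assms(2)] by (auto simp: bounded_iff)
  have Bp: "0 \<le> B" using assms(1) B by fastforce
  \<comment> \<open>8 M + B + 1 meets the three lower bounds on l in
    \<open>exists_darboux_null\<close>, where B \<ge> 0 because K is nonempty; the summand n drives
    the error 8 M^2 / l(n) to 0.\<close>
  define l where "l n = 8 * M + B + 1 + real n" for n
  have "\<exists>J' \<rho>. J' \<in> R0 K \<and> associated_measure J' \<rho> \<and> emeasure \<rho> K = 0 \<and>
    (\<forall>k. \<bar>fst J' k - a k\<bar> \<le> 8 * M\<^sup>2 / l n) \<and> (\<forall>k. \<bar>snd J' k - b k\<bar> \<le> 8 * M\<^sup>2 / l n)" for n
    using assms(4) M B Bp unfolding J
    by (intro exists_darboux_null[OF assms(2,3)]) (auto simp: l_def)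
  then obtain Jn \<rho> where Jn: "\<And>n. Jn n \<in> R0 K" "\<And>n. associated_measure (Jn n) (\<rho> n)" "\<And>n. emeasure (\<rho> n) K = 0"
    and close: "\<And>n k. \<bar>fst (Jn n) k - a k\<bar> \<le> 8 * M\<^sup>2 / l n" "\<And>n k. \<bar>snd (Jn n) k - b k\<bar> \<le> 8 * M\<^sup>2 / l n"
    by metis
  have "(\<lambda>n. jacobi_dist (Jn n) J) \<longlonglongrightarrow> 0"
  proof (rule tendsto_sandwich[OF always_eventually always_eventually tendsto_const], safe)
    fix n
    show "0 \<le> jacobi_dist (Jn n) J"
      "jacobi_dist (Jn n) J \<le> (\<Sum>\<^sub>\<infinity>n::int. 2 powi (- \<bar>n\<bar>)) * (2 * (8 * M\<^sup>2 / l n))"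
      using jacobi_dist_bound[of "fst (Jn n)" a "8 * M\<^sup>2 / l n" "snd (Jn n)" b] close by (simp_all add: J)
  next
    have "filterlim l at_top sequentially"
      unfolding l_def by (intro filterlim_tendsto_add_at_top[OF tendsto_const] filterlim_real_sequentially)
    then have "(\<lambda>n. 8 * M\<^sup>2 / l n) \<longlonglongrightarrow> 0"
      by (intro real_tendsto_divide_at_top[OF tendsto_const])
    then have "(\<lambda>n. (\<Sum>\<^sub>\<infinity>n::int. 2 powi (- \<bar>n\<bar>)) * (2 * (8 * M\<^sup>2 / l n))) \<longlonglongrightarrow> (\<Sum>\<^sub>\<infinity>n::int. 2 powi (- \<bar>n\<bar>)) * (2 * 0)"
      by (intro tendsto_mult tendsto_const)
    then show "(\<lambda>n. (\<Sum>\<^sub>\<infinity>n::int. 2 powi (- \<bar>n\<bar>)) * (2 * (8 * M\<^sup>2 / l n))) \<longlonglongrightarrow> 0" by simp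
  qed
  then show ?thesis using Jn by blast
qed

end
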